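(* Let $m\ge1$ be an integer and let $E_1,\dots,E_m,F$ be infinite-dimensional Banach spaces over $\mathbb{K}=\mathbb{R}$ or $\mathbb{C}$. Suppose that $F$ has finite cotype with $\cot(F)=r<\infty$, that $1\le s<2$, that $m<\frac{s}{r(s-1)}$ (no restriction when $s=1$), and let $t=\frac{sr}{s-msr+mr}$. Then for real numbers $p,q$: (a) If $0<p\le t$ and $\frac{mrt}{r-t+mrt}\le q$, then $\eta^{m-mult}_{(p,q)}(E_1,\dots,E_m;F)\le \frac{m}{p}+m-\frac{1}{r}-\frac{m}{q}-\frac{m-1}{t}$. (b) If $0<p\le t$ and $0<q\le\frac{mrt}{r-t+mrt}$, then $\eta^{m-mult}_{(p,q)}(E_1,\dots,E_m;F)\le \frac{m}{p}-\frac{m}{t}$. (c) If $0<t\le p$ and $\frac{mrt}{r-t+mrt}\le q$, then $\eta^{m-mult}_{(p,q)}(E_1,\dots,E_m;F)\le m-\frac{1}{r}+\frac{1}{t}-\frac{m}{q}$. (d) If $0<t\le p$ and $0<q\le\frac{mrt}{r-t+mrt}$, then $\eta^{m-mult}_{(p,q)}(E_1,\dots,E_m;F)=0$.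
   Context: A Banach space $X$ has cotype $\rho$ ($2\le \rho\le\infty$) if there is $C\ge0$ such that for all finite families $x_1,\dots,x_n\in X$, $\big(\sum_{k=1}^n\|x_k\|^\rho\big)^{1/\rho}\le C\big(\int_0^1\|\sum_{k=1}^n r_k(u)x_k\|^2du\big)^{1/2}$, where $r_k$ are the Rademacher functions (for $\rho=\infty$ the left side is $\max_k\|x_k\|$). $\cot(X)=\inf\{\rho: X\text{ has cotype }\rho\}$. $\mathcal{L}(E_1,\dots,E_m;F)$ is the space of continuous $m$-linear operators $E_1\times\cdots\times E_m\to F$. For $0<q<\infty$ and $x_1,\dots,x_n$ in a Banach space $E$, put $\|(x_k)_{k=1}^n\|_{w,q}=\sup_{\varphi\in B_{E^*}}\big(\sum_{k=1}^n|\varphi(x_k)|^q\big)^{1/q}$, where $B_{E^*}$ is the closed unit ball of the dual $E^*$. For $0<p,q<\infty$, the multilinear $m$-index of $(p,q)$-summability $\eta^{m-mult}_{(p,q)}(E_1,\dots,E_m;F)$ is the infimum of all $\sigma\ge0$ such that for every $T\in\mathcal{L}(E_1,\dots,E_m;F)$ there is a constant $C\ge0$ (not depending on $n$ or on the vectors) with $$\Big(\sum_{k_1,\dots,k_m=1}^n\|T(x^{(1)}_{k_1},\dots,x^{(m)}_{k_m})\|^p\Big)^{1/p}\le C\,n^{\sigma}\prod_{i=1}^m\|(x^{(i)}_{k})_{k=1}^n\|_{w,q}$$ for all positive integers $n$ and all $x^{(i)}_k\in E_i$, $1\le k\le n$, $1\le i\le m$. *)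

theory Defs
  imports "HOL-Analysis.Analysis"
begin

section \<open>Scalars and normed spaces over them\<close>

text \<open>
  The library only has real normed spaces. The scalar field is a type of the following class,
  whose members are, up to isometric isomorphism, exactly \<open>\<real>\<close> and \<open>\<complex>\<close>.
\<close>

class real_or_complex = real_normed_field +
  assumes ex_isometry_onto_real_or_complex:
    "\<exists>f :: 'a \<Rightarrow> complex.
       (\<forall>x y. f (x + y) = f x + f y) \<and> (\<forall>x y. f (x * y) = f x * f y) \<and> f 1 = 1 \<and>
       (\<forall>x. cmod (f x) = norm x) \<and> (range f = \<real> \<or> range f = UNIV)"

instance real :: real_or_complex
proof
  show "\<exists>f :: real \<Rightarrow> complex.
       (\<forall>x y. f (x + y) = f x + f y) \<and> (\<forall>x y. f (x * y) = f x * f y) \<and> f 1 = 1 \<and>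
       (\<forall>x. cmod (f x) = norm x) \<and> (range f = \<real> \<or> range f = UNIV)"
    by (intro exI[of _ complex_of_real]) (auto simp: Reals_def)
qed

instance complex :: real_or_complex
proof
  show "\<exists>f :: complex \<Rightarrow> complex.
       (\<forall>x y. f (x + y) = f x + f y) \<and> (\<forall>x y. f (x * y) = f x * f y) \<and> f 1 = 1 \<and>
       (\<forall>x. cmod (f x) = norm x) \<and> (range f = \<real> \<or> range f = UNIV)"
    by (intro exI[of _ id]) auto
qed

text \<open>
  A normed space over \<open>'k\<close>: the norm and the underlying real structure are those of the type,
  the scalar multiplication by \<open>'k\<close> is an explicit parameter extending \<open>(*\<^sub>R)\<close>.
\<close>

locale normed_space_over = vector_space smul
  for smul :: "'k::real_or_complex \<Rightarrow> 'v::real_normed_vector \<Rightarrow> 'v" +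
  assumes norm_scale: "norm (smul c x) = norm c * norm x"
    and scale_of_real: "smul (of_real a) x = a *\<^sub>R x"

lemma normed_space_over_scaleR:
  "normed_space_over ((*\<^sub>R) :: real \<Rightarrow> 'v::real_normed_vector \<Rightarrow> 'v)"
  by unfold_locales (simp_all add: algebra_simps)

lemma normed_space_over_complex: "normed_space_over ((*) :: complex \<Rightarrow> complex \<Rightarrow> complex)"
  by unfold_locales (simp_all add: algebra_simps norm_mult scaleR_conv_of_real)

definition infinite_dimensional ::
    "('k::real_or_complex \<Rightarrow> 'v::real_normed_vector \<Rightarrow> 'v) \<Rightarrow> 'v set \<Rightarrow> bool" where
  "infinite_dimensional smul S \<longleftrightarrow> \<not> (\<exists>B. finite B \<and> B \<subseteq> S \<and> S \<subseteq> module.span smul B)"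

text \<open>
  A family of Banach spaces \<open>E 1, \<dots>, E m\<close> with \<open>m\<close> a variable cannot be a family of types. It is
  represented by closed subspaces of one Banach space type. This is no restriction, because any
  finitely many Banach spaces are isometric to closed subspaces of their direct sum. No relation
  between the subspaces is assumed, and the ambient space plays no role in the notions below.
\<close>

definition banach_subspace ::
    "('k::real_or_complex \<Rightarrow> 'v::banach \<Rightarrow> 'v) \<Rightarrow> 'v set \<Rightarrow> bool" where
  "banach_subspace smul S \<longleftrightarrow> module.subspace smul S \<and> closed S"


section \<open>Cotype\<close>

definition rademacher :: "nat \<Rightarrow> real \<Rightarrow> real" where
  "rademacher k u = sgn (sin (2 ^ k * pi * u))"

definition has_cotype :: "'v::banach itself \<Rightarrow> ereal \<Rightarrow> bool" where
  "has_cotype _ \<rho> \<longleftrightarrow> 2 \<le> \<rho> \<and>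
     (\<exists>C\<ge>0. \<forall>n\<ge>1. \<forall>x :: nat \<Rightarrow> 'v.
        (if \<rho> = \<infinity> then Max ((\<lambda>k. norm (x k)) ` {1..n})
         else (\<Sum>k=1..n. norm (x k) powr real_of_ereal \<rho>) powr (1 / real_of_ereal \<rho>))
        \<le> C * sqrt (LINT u:{0..1}|lborel. (norm (\<Sum>k=1..n. rademacher k u *\<^sub>R x k))\<^sup>2))"

definition inf_cotype :: "'v::banach itself \<Rightarrow> ereal" where
  "inf_cotype X = Inf {\<rho>. has_cotype X \<rho>}"


section \<open>Weak norms\<close>

text \<open>
  The closed unit ball of the dual of the subspace \<open>S\<close>. Its members are functionals on \<open>S\<close>; their
  values outside \<open>S\<close> are irrelevant and left arbitrary.
\<close>

definition dual_unit_ball ::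
    "('k::real_or_complex \<Rightarrow> 'v::banach \<Rightarrow> 'v) \<Rightarrow> 'v set \<Rightarrow> ('v \<Rightarrow> 'k) set" where
  "dual_unit_ball smul S =
     {\<phi>. (\<forall>x\<in>S. \<forall>y\<in>S. \<phi> (x + y) = \<phi> x + \<phi> y) \<and> (\<forall>c. \<forall>x\<in>S. \<phi> (smul c x) = c * \<phi> x) \<and>
         (\<forall>x\<in>S. norm (\<phi> x) \<le> norm x)}"

definition weak_norm ::
    "('k::real_or_complex \<Rightarrow> 'v::banach \<Rightarrow> 'v) \<Rightarrow> 'v set \<Rightarrow> real \<Rightarrow> nat \<Rightarrow> (nat \<Rightarrow> 'v) \<Rightarrow> real" where
  "weak_norm smul S q n x =
     (SUP \<phi>\<in>dual_unit_ball smul S. (\<Sum>k=1..n. norm (\<phi> (x k)) powr q) powr (1 / q))"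


section \<open>Multilinear operators and the index of summability\<close>

text \<open>
  The product \<open>E 1 \<times> \<dots> \<times> E m\<close> is the extensional product, so that the topology it
  inherits from the function type is the product topology of the factors.
\<close>

definition continuous_multilinear ::
    "('k::real_or_complex \<Rightarrow> 'v::banach \<Rightarrow> 'v) \<Rightarrow> ('k \<Rightarrow> 'w::banach \<Rightarrow> 'w) \<Rightarrow>
     nat \<Rightarrow> (nat \<Rightarrow> 'v set) \<Rightarrow> ((nat \<Rightarrow> 'v) \<Rightarrow> 'w) set" where
  "continuous_multilinear scaleE scaleF m E =
     {T. continuous_on (\<Pi>\<^sub>E i\<in>{1..m}. E i) T \<and>
         (\<forall>x\<in>(\<Pi>\<^sub>E i\<in>{1..m}. E i). \<forall>i\<in>{1..m}.
            (\<forall>u\<in>E i. \<forall>v\<in>E i. T (x(i := u + v)) = T (x(i := u)) + T (x(i := v))) \<and>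
            (\<forall>c. \<forall>u\<in>E i. T (x(i := scaleE c u)) = scaleF c (T (x(i := u)))))}"

definition mult_index ::
    "('k::real_or_complex \<Rightarrow> 'v::banach \<Rightarrow> 'v) \<Rightarrow> ('k \<Rightarrow> 'w::banach \<Rightarrow> 'w) \<Rightarrow>
     nat \<Rightarrow> (nat \<Rightarrow> 'v set) \<Rightarrow> real \<Rightarrow> real \<Rightarrow> ereal" where
  "mult_index scaleE scaleF m E p q =
     Inf (ereal ` {\<sigma>. 0 \<le> \<sigma> \<and>
       (\<forall>T\<in>continuous_multilinear scaleE scaleF m E. \<exists>C\<ge>0. \<forall>n\<ge>1. \<forall>x :: nat \<Rightarrow> nat \<Rightarrow> 'v.
          (\<forall>i\<in>{1..m}. \<forall>k\<in>{1..n}. x i k \<in> E i) \<longrightarrow>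
          (\<Sum>k\<in>{1..m} \<rightarrow>\<^sub>E {1..n}. norm (T (\<lambda>i\<in>{1..m}. x i (k i))) powr p) powr (1 / p)
          \<le> C * real n powr \<sigma> * (\<Prod>i=1..m. weak_norm scaleE (E i) q n (x i)))})"

end

theory Submission
  imports Defs
begin

text \<open>
  If \<open>F\<close> has cotype \<open>\<rho>\<close>, applying the cotype inequality to one variable after the other
  and bounding the resulting signed sums \<open>\<Sum>k. \<epsilon> k *\<^sub>R x k\<close> by weak 1-norms shows that every
  operator is multiple \<open>(\<rho>; 1)\<close>-summing. Replacing \<open>x k\<close> by \<open>a k *\<^sub>R x k\<close> in one variable and
  optimising over \<open>a\<close> raises the weak exponent of that variable from 1 to \<open>s\<close> at the cost of
  \<open>1 - 1 / s\<close> in the reciprocal of the strong exponent. After \<open>m\<close> such steps the operator is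
  multiple \<open>(t'; s)\<close>-summing with \<open>1 / t' = 1 / \<rho> - m * (1 - 1 / s)\<close>, where \<open>t' \<rightarrow> t\<close> as \<open>\<rho> \<rightarrow> r\<close>.
  The critical value \<open>m * r * t / (r - t + m * r * t)\<close> is just \<open>s\<close>, and all four cases follow by
  comparing \<open>p\<close> with \<open>t'\<close> and \<open>q\<close> with \<open>s\<close> by Hoelder's inequality, respectively by
  the monotonicity of the norms of the sequence spaces.
\<close>

section \<open>Norms of finite sequences\<close>

text \<open>Meant for nonnegative entries, so no absolute values occur. For exponents below 1 this
  is only a quasi-norm; no triangle inequality is used.\<close>

definition ell :: "real \<Rightarrow> 'i set \<Rightarrow> ('i \<Rightarrow> real) \<Rightarrow> real" where
  "ell p A a = (\<Sum>i\<in>A. a i powr p) powr (1 / p)"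

lemma ell_nonneg: "0 \<le> ell p A a"
  by (simp add: ell_def)

lemma ell_powr: "p \<noteq> 0 \<Longrightarrow> ell p A a powr p = (\<Sum>i\<in>A. a i powr p)"
  by (simp add: ell_def powr_powr sum_nonneg)

lemma ell_mono:
  assumes "p > 0" "\<And>i. i \<in> A \<Longrightarrow> 0 \<le> a i" "\<And>i. i \<in> A \<Longrightarrow> a i \<le> b i"
  shows "ell p A a \<le> ell p A b"
  unfolding ell_def using assms by (intro powr_mono2 sum_mono sum_nonneg) auto

lemma ell_ge:
  assumes "p > 0" "finite A" "i \<in> A" "0 \<le> a i"
  shows "a i \<le> ell p A a"
proof -
  have "a i powr p \<le> (\<Sum>i\<in>A. a i powr p)"
    using assms by (intro member_le_sum) auto
  then have "(a i powr p) powr (1 / p) \<le> ell p A a"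
    unfolding ell_def using assms by (intro powr_mono2) auto
  then show ?thesis
    using assms by (simp add: powr_powr)
qed

text \<open>Every entry is at most the \<open>p\<close>-norm \<open>S\<close>, so
  \<open>a i powr q\<close> is at most \<open>a i powr p * S powr (q - p)\<close>, and summing turns
  the first factor into \<open>S powr p\<close>.\<close>

lemma ell_antimono_exponent:
  assumes "0 < p" "p \<le> q" "finite A" "\<And>i. i \<in> A \<Longrightarrow> 0 \<le> a i"
  shows "ell q A a \<le> ell p A a"
proof -
  let ?S = "ell p A a"
  have "(\<Sum>i\<in>A. a i powr q) \<le> (\<Sum>i\<in>A. a i powr p * ?S powr (q - p))"
  proof (rule sum_mono)
    fix i assume i: "i \<in> A"
    have "a i powr q = a i powr p * a i powr (q - p)"
      by (simp flip: powr_add)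
    also have "\<dots> \<le> a i powr p * ?S powr (q - p)"
      using assms i ell_ge[of p A i a] by (intro mult_left_mono powr_mono2) auto
    finally show "a i powr q \<le> a i powr p * ?S powr (q - p)" .
  qed
  also have "\<dots> = ?S powr p * ?S powr (q - p)"
    using assms by (simp add: ell_powr sum_distrib_right)
  also have "\<dots> = ?S powr q"
    by (simp flip: powr_add)
  finally have "ell q A a \<le> (?S powr q) powr (1 / q)"
    unfolding ell_def[of q] using assms by (intro powr_mono2 sum_nonneg) auto
  then show ?thesis
    using assms by (simp add: powr_powr ell_nonneg)
qed

text \<open>Young's inequality, applied entry by entry after both sequences are scaled to norm 1. A
  sequence of norm 0 cannot be scaled, but then all its entries vanish.\<close>

lemma Holder_sum:
  fixes a b :: "'i \<Rightarrow> real"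
  assumes p: "p > 1" and q: "q > 1" and pq: "1 / p + 1 / q = 1" and A: "finite A"
    and a: "\<And>i. i \<in> A \<Longrightarrow> 0 \<le> a i" and b: "\<And>i. i \<in> A \<Longrightarrow> 0 \<le> b i"
  shows "(\<Sum>i\<in>A. a i * b i) \<le> ell p A a * ell q A b"
proof (cases "ell p A a = 0 \<or> ell q A b = 0")
  case True
  have "a i * b i = 0" if "i \<in> A" for i
    using True ell_ge[of p A i a] ell_ge[of q A i b] that p q A a[OF that] b[OF that] by fastforce
  then have "(\<Sum>i\<in>A. a i * b i) = 0"
    by (rule sum.neutral[OF ballI])
  then show ?thesis
    by (simp add: ell_nonneg)
next
  case False
  define X where "X = ell p A a"
  define Y where "Y = ell q A b"
  have XY: "X > 0" "Y > 0"
    using False ell_nonneg[of p A a] ell_nonneg[of q A b] by (auto simp: X_def Y_def)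
  have "(\<Sum>i\<in>A. a i / X * (b i / Y)) \<le> (\<Sum>i\<in>A. (a i / X) powr p / p + (b i / Y) powr q / q)"
    using p q pq a b XY by (intro sum_mono Youngs_inequality) auto
  also have "\<dots> = (\<Sum>i\<in>A. a i powr p) / X powr p / p + (\<Sum>i\<in>A. b i powr q) / Y powr q / q"
    using a b XY by (simp add: sum.distrib powr_divide sum_divide_distrib)
  also have "(\<Sum>i\<in>A. a i powr p) = X powr p"
    using p by (simp add: X_def ell_powr)
  also have "(\<Sum>i\<in>A. b i powr q) = Y powr q"
    using q by (simp add: Y_def ell_powr)
  also have "X powr p / X powr p / p + Y powr q / Y powr q / q = 1"
    using XY pq by simp
  finally have "(\<Sum>i\<in>A. a i * b i) / (X * Y) \<le> 1"
    by (simp add: sum_divide_distrib)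
  then show ?thesis
    using XY by (simp add: X_def Y_def field_simps)
qed

text \<open>Hoelder's inequality for the sequences \<open>a i powr t\<close> and 1 with the
  exponents \<open>p / t\<close> and \<open>p / (p - t)\<close>, followed by a \<open>t\<close>-th
  root.\<close>

lemma ell_le_card:
  assumes "0 < t" "t \<le> p" "finite A" "\<And>i. i \<in> A \<Longrightarrow> 0 \<le> a i"
  shows "ell t A a \<le> real (card A) powr (1 / t - 1 / p) * ell p A a"
proof (cases "t = p \<or> A = {}")
  case True
  then show ?thesis
    using assms by (auto simp: ell_def)
next
  case False
  then have tp: "t < p" and c: "card A > 0"
    using assms by (auto simp: card_gt_0_iff)
  define u where "u = p / t"
  define v where "v = p / (p - t)"
  have uv: "u > 1" "v > 1" "1 / u + 1 / v = 1"
    using tp assms by (auto simp: u_def v_def field_simps)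
  have "(\<Sum>i\<in>A. a i powr t * 1) \<le> ell u A (\<lambda>i. a i powr t) * ell v A (\<lambda>_. 1)"
    using uv assms by (intro Holder_sum) auto
  also have "ell v A (\<lambda>_. 1) = real (card A) powr (1 - t / p)"
    using assms by (simp add: ell_def v_def diff_divide_distrib)
  also have "ell u A (\<lambda>i. a i powr t) = ell p A a powr t"
    using assms by (simp add: ell_def u_def powr_powr)
  finally have "ell t A a \<le> (ell p A a powr t * real (card A) powr (1 - t / p)) powr (1 / t)"
    unfolding ell_def[of t] using assms by (intro powr_mono2 sum_nonneg) auto
  also have "\<dots> = real (card A) powr (1 / t - 1 / p) * ell p A a"
    using assms by (simp add: powr_mult powr_powr ell_nonneg diff_divide_distrib left_diff_distrib)
  finally show ?thesis .
qed

text \<open>Lowering the exponent costs a power of the cardinality, raising it costs nothing.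
  Joining both in one \<open>max\<close> lets the four cases of the theorem come from a single
  estimate.\<close>

lemma ell_le_card_max:
  assumes "0 < t" "0 < p" "finite A" "A \<noteq> {}" "\<And>i. i \<in> A \<Longrightarrow> 0 \<le> a i"
  shows "ell t A a \<le> real (card A) powr (max 0 (1 / t - 1 / p)) * ell p A a"
proof (cases "t \<le> p")
  case True
  then have "1 / p \<le> 1 / t"
    using assms by (simp add: frac_le)
  then show ?thesis
    using ell_le_card[OF assms(1) True assms(3,5)] by (simp add: max_def)
next
  case False
  then have "1 / t \<le> 1 / p"
    using assms by (simp add: frac_le)
  then show ?thesis
    using ell_antimono_exponent[of p t A a] False assms by (simp add: max_def card_gt_0_iff)
qed

section \<open>The Hahn--Banach theorem\<close>

definition sublinear :: "('a::real_vector \<Rightarrow> real) \<Rightarrow> bool" where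
  "sublinear q \<longleftrightarrow> (\<forall>x y. q (x + y) \<le> q x + q y) \<and> (\<forall>c\<ge>0. \<forall>x. q (c *\<^sub>R x) = c * q x)"

text \<open>The inequality for the factor \<open>1 / c\<close> at the vector
  \<open>c *\<^sub>R x\<close> is the reverse one, so one direction of homogeneity suffices.\<close>

lemma sublinearI:
  assumes "\<And>x y. q (x + y) \<le> q x + q y" "\<And>c x. c > 0 \<Longrightarrow> q (c *\<^sub>R x) \<le> c * q x" "q 0 = 0"
  shows "sublinear q"
proof -
  have "q (c *\<^sub>R x) = c * q x" if "c \<ge> 0" for c x
  proof (cases "c = 0")
    case False
    then have "c > 0" using that by simp
    then have "c * q ((1 / c) *\<^sub>R c *\<^sub>R x) \<le> c * (1 / c * q (c *\<^sub>R x))"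
      by (intro mult_left_mono assms(2)) auto
    then show ?thesis
      using assms(2)[of c x] \<open>c > 0\<close> by simp
  qed (simp add: assms)
  then show ?thesis
    using assms by (simp add: sublinear_def)
qed

lemma sublinear_0: "sublinear q \<Longrightarrow> q 0 = 0"
  unfolding sublinear_def by (metis mult_zero_left order_refl scaleR_zero_left)

lemma sublinear_ge: "sublinear q \<Longrightarrow> - q (- x) \<le> q x"
  unfolding sublinear_def using sublinear_0[unfolded sublinear_def, of q]
  by (smt (verit) add.right_inverse)

lemma sublinear_norm: "sublinear norm"
  by (simp add: sublinear_def norm_triangle_ineq)

text \<open>A minimal sublinear functional \<open>q\<close> equals \<open>lower_along q y\<close> for every \<open>y\<close>, hence is odd and
  therefore linear. Applied to the norm, the same construction makes \<open>y\<close> a vector at which a linear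
  minorant attains the norm.\<close>

definition lower_along :: "('a::real_vector \<Rightarrow> real) \<Rightarrow> 'a \<Rightarrow> 'a \<Rightarrow> real" where
  "lower_along q y x = (INF t\<in>{0..}. q (x + t *\<^sub>R y) - t * q y)"

text \<open>The infimum is finite because subadditivity bounds its terms below by
  \<open>- q (- x)\<close>. The parameters 0 and 1 give the two estimates. Sublinearity comes from
  combining parameters: \<open>t + t'\<close> for a sum, \<open>c * t\<close> for a
  multiple.\<close>

lemma
  assumes q: "sublinear q"
  shows sublinear_lower_along: "sublinear (lower_along q y)"
    and lower_along_le: "lower_along q y x \<le> q x"
    and lower_along_minus: "lower_along q y (- y) \<le> - q y"
proof -
  have add: "q (u + v) \<le> q u + q v" and scale: "c \<ge> 0 \<Longrightarrow> q (c *\<^sub>R u) = c * q u" for u v c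
    using q by (auto simp: sublinear_def)
  have bdd: "bdd_below ((\<lambda>t. q (x + t *\<^sub>R y) - t * q y) ` {0..})" for x
  proof (rule bdd_belowI2)
    fix t :: real assume "t \<in> {0..}"
    then show "- q (- x) \<le> q (x + t *\<^sub>R y) - t * q y"
      using add[of "x + t *\<^sub>R y" "- x"] scale[of t y] by simp
  qed
  have le: "lower_along q y x \<le> q (x + t *\<^sub>R y) - t * q y" if "t \<ge> 0" for x t
    unfolding lower_along_def using that by (intro cINF_lower bdd) auto
  show "lower_along q y x \<le> q x" for x
    using le[of 0 x] by simp
  show "lower_along q y (- y) \<le> - q y"
    using le[of 1 "- y"] sublinear_0[OF q] by simp
  show "sublinear (lower_along q y)"
  proof (rule sublinearI)
    fix x x'
    have "lower_along q y (x + x') - (q (x' + t' *\<^sub>R y) - t' * q y) \<le> q (x + t *\<^sub>R y) - t * q y"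
      if "t \<ge> 0" "t' \<ge> 0" for t t'
      using le[of "t + t'" "x + x'"] add[of "x + t *\<^sub>R y" "x' + t' *\<^sub>R y"] that
      by (simp add: algebra_simps)
    then have "lower_along q y (x + x') - (q (x' + t' *\<^sub>R y) - t' * q y) \<le> lower_along q y x"
      if "t' \<ge> 0" for t'
      unfolding lower_along_def[of q y x] using that by (intro cINF_greatest) auto
    then have "lower_along q y (x + x') - lower_along q y x \<le> lower_along q y x'"
      unfolding lower_along_def[of q y x'] by (intro cINF_greatest) (auto simp: algebra_simps)
    then show "lower_along q y (x + x') \<le> lower_along q y x + lower_along q y x'"
      by simp
  next
    fix c :: real and x assume c: "c > 0"
    have "lower_along q y (c *\<^sub>R x) / c \<le> q (x + t *\<^sub>R y) - t * q y" if "t \<ge> 0" for t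
      using le[of "c * t" "c *\<^sub>R x"] scale[of c "x + t *\<^sub>R y"] that c by (simp add: field_simps)
    then have "lower_along q y (c *\<^sub>R x) / c \<le> lower_along q y x"
      unfolding lower_along_def[of q y x] by (intro cINF_greatest) auto
    then show "lower_along q y (c *\<^sub>R x) \<le> c * lower_along q y x"
      using c by (simp add: field_simps)
  next
    have "(\<lambda>t. q (0 + t *\<^sub>R y) - t * q y) ` {0..} = {0}"
      using scale by force
    then show "lower_along q y 0 = 0"
      unfolding lower_along_def by simp
  qed
qed

text \<open>Provides the bounds that Zorn's lemma asks for. The infimum is finite since each member
  is at least \<open>- p (- x)\<close> at \<open>x\<close>. Subadditivity uses the chain condition:
  two members, one evaluated at \<open>x\<close> and one at \<open>y\<close>, are both replaced by
  the smaller of them.\<close>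

lemma sublinear_INF_chain:
  fixes p :: "'a::real_vector \<Rightarrow> real"
  assumes "C \<noteq> {}" and C: "\<And>q. q \<in> C \<Longrightarrow> sublinear q \<and> q \<le> p"
    and chain: "\<And>q q'. q \<in> C \<Longrightarrow> q' \<in> C \<Longrightarrow> q \<le> q' \<or> q' \<le> q"
  shows "sublinear (\<lambda>x. INF q\<in>C. q x)" and "q \<in> C \<Longrightarrow> (INF q\<in>C. q x) \<le> q x"
proof -
  have bdd: "bdd_below ((\<lambda>q. q x) ` C)" for x
  proof (rule bdd_belowI2)
    fix q assume "q \<in> C"
    then show "- p (- x) \<le> q x"
      using sublinear_ge[of q x] C[of q] le_funD[of q p "- x"] by auto
  qed
  have le: "(INF q\<in>C. q x) \<le> q x" if "q \<in> C" for q x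
    using that bdd by (intro cINF_lower)
  then show "q \<in> C \<Longrightarrow> (INF q\<in>C. q x) \<le> q x" .
  show "sublinear (\<lambda>x. INF q\<in>C. q x)"
  proof (rule sublinearI)
    fix x y
    have "(INF q\<in>C. q (x + y)) - q' y \<le> q x" if "q \<in> C" "q' \<in> C" for q q'
    proof -
      have "q \<le> q' \<or> q' \<le> q"
        using that by (rule chain)
      with that obtain q'' where q'': "q'' \<in> C" "q'' \<le> q" "q'' \<le> q'"
        by blast
      have "(INF q\<in>C. q (x + y)) \<le> q'' x + q'' y"
        using le[OF q''(1), of "x + y"] C[OF q''(1)] unfolding sublinear_def by (meson order_trans)
      then show ?thesis
        using le_funD[OF q''(2), of x] le_funD[OF q''(3), of y] by simp
    qed
    then have "(INF q\<in>C. q (x + y)) - q' y \<le> (INF q\<in>C. q x)" if "q' \<in> C" for q'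
      using that \<open>C \<noteq> {}\<close> by (intro cINF_greatest) auto
    then have "(INF q\<in>C. q (x + y)) - (INF q\<in>C. q x) \<le> (INF q\<in>C. q y)"
      using \<open>C \<noteq> {}\<close> by (intro cINF_greatest) (auto simp: algebra_simps)
    then show "(INF q\<in>C. q (x + y)) \<le> (INF q\<in>C. q x) + (INF q\<in>C. q y)"
      by simp
  next
    fix c :: real and x :: 'a assume c: "c > 0"
    have "(INF q\<in>C. q (c *\<^sub>R x)) / c \<le> q x" if "q \<in> C" for q
      using le[OF that, of "c *\<^sub>R x"] C[OF that] c by (simp add: sublinear_def field_simps)
    then have "(INF q\<in>C. q (c *\<^sub>R x)) / c \<le> (INF q\<in>C. q x)"
      using \<open>C \<noteq> {}\<close> by (intro cINF_greatest) auto
    then show "(INF q\<in>C. q (c *\<^sub>R x)) \<le> c * (INF q\<in>C. q x)"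
      using c by (simp add: field_simps)
  next
    have "(\<lambda>q. q 0) ` C = {0}"
      using \<open>C \<noteq> {}\<close> C sublinear_0 by force
    then show "(INF q\<in>C. q (0::'a)) = 0"
      by simp
  qed
qed

lemma ex_linear_le_sublinear:
  fixes p :: "'a::real_vector \<Rightarrow> real"
  assumes "sublinear p"
  shows "\<exists>f. linear f \<and> (\<forall>x. f x \<le> p x)"
proof -
  let ?A = "{q. sublinear q \<and> q \<le> p}"
  \<comment> \<open>The order is reversed, so that the maximal element supplied by Zorn's lemma is a
    minimal functional.\<close>
  let ?P = "\<lambda>q q' :: 'a \<Rightarrow> real. q' \<le> q"
  have "\<exists>m\<in>?A. \<forall>q\<in>?A. ?P m q \<longrightarrow> q = m"
  proof (rule predicate_Zorn)
    show "partial_order_on ?A (relation_of ?P ?A)"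
      by (rule partial_order_on_relation_ofI) auto
  next
    fix C assume C: "C \<in> Chains (relation_of ?P ?A)"
    then have C': "q \<in> ?A" "q' \<in> C \<Longrightarrow> q \<le> q' \<or> q' \<le> q" if "q \<in> C" for q q'
      using that by (auto simp: Chains_def relation_of_def)
    show "\<exists>u\<in>?A. \<forall>q\<in>C. ?P q u"
    proof (cases "C = {}")
      case False
      then obtain q0 where "q0 \<in> C" by blast
      let ?u = "\<lambda>x. INF q\<in>C. q x"
      have u: "sublinear ?u" "\<And>q x. q \<in> C \<Longrightarrow> ?u x \<le> q x"
        using sublinear_INF_chain[OF False, of p] C' by auto
      moreover have "?u \<le> p"
        using u(2)[OF \<open>q0 \<in> C\<close>] C'(1)[OF \<open>q0 \<in> C\<close>] by (auto simp: le_fun_def intro: order_trans)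
      ultimately show ?thesis
        by (intro bexI[of _ ?u]) (auto simp: le_fun_def)
    qed (use assms in auto)
  qed
  then obtain m where m: "sublinear m" "m \<le> p" "\<And>q. sublinear q \<Longrightarrow> q \<le> p \<Longrightarrow> q \<le> m \<Longrightarrow> q = m"
    by blast
  have "lower_along m y = m" for y
    using m(1) order_trans[OF lower_along_le[OF m(1)] le_funD[OF m(2)]] lower_along_le[OF m(1)]
    by (intro m(3) sublinear_lower_along) (auto simp: le_fun_def)
  then have odd: "m (- y) = - m y" for y
    using lower_along_minus[OF m(1), of y] sublinear_ge[OF m(1), of "- y"] by simp
  have add_le: "m (x + y) \<le> m x + m y" for x y
    using m(1) by (simp add: sublinear_def)
  have "linear m"
  proof (rule linearI)
    \<comment> \<open>Subadditivity for \<open>x = (x + y) + (- y)\<close> together with oddness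
      yields the missing inequality.\<close>
    show "m (x + y) = m x + m y" for x y
      using add_le[of x y] add_le[of "x + y" "- y"] odd[of y] by simp
    show "m (c *\<^sub>R x) = c *\<^sub>R m x" for c x
    proof (cases "c \<ge> 0")
      case False
      then have "m ((- c) *\<^sub>R (- x)) = (- c) * m (- x)"
        using m(1) unfolding sublinear_def by (metis less_eq_real_def neg_0_le_iff_le not_le)
      then show ?thesis
        using odd[of x] by simp
    qed (use m(1) in \<open>auto simp: sublinear_def\<close>)
  qed
  then show ?thesis
    using m(2) by (auto simp: le_fun_def)
qed

text \<open>A linear minorant \<open>f\<close> of \<open>lower_along norm y\<close> satisfies
  \<open>f (- y) \<le> - norm y\<close>, so the bound by the norm is attained at
  \<open>y\<close>.\<close>

lemma ex_linear_norming:
  fixes y :: "'a::real_normed_vector"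
  shows "\<exists>f. linear f \<and> (\<forall>x. \<bar>f x\<bar> \<le> norm x) \<and> f y = norm y"
proof -
  obtain f where f: "linear f" "\<And>x. f x \<le> lower_along norm y x"
    using ex_linear_le_sublinear[OF sublinear_lower_along[OF sublinear_norm]] by metis
  have le: "f x \<le> norm x" for x
    using f(2)[of x] lower_along_le[OF sublinear_norm, of y x] by simp
  have neg: "f (- x) = - f x" for x
    using f(1) by (rule linear_neg)
  have "\<bar>f x\<bar> \<le> norm x" for x
    using le[of x] le[of "- x"] neg[of x] by auto
  moreover have "f y = norm y"
    using f(2)[of "- y"] lower_along_minus[OF sublinear_norm, of y] neg[of y] le[of y] by simp
  ultimately show ?thesis
    using f(1) by auto
qed

section \<open>Dual unit balls\<close>

text \<open>Makes the class axiom usable. Pulling the imaginary unit back along the isometry yields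
  \<open>j\<close>; the last clause of the complex case is the inequality between real part and
  modulus.\<close>

lemma real_or_complex_cases:
  obtains (real) "\<And>c :: 'k::real_or_complex. \<exists>a. c = of_real a"
  | (complex) j :: "'k::real_or_complex" where "j * j = - 1" "norm j = 1"
      "\<And>c. \<exists>a b. c = of_real a + of_real b * j" "\<And>a b. \<bar>a\<bar> \<le> norm (of_real a + of_real b * j)"
proof -
  obtain f :: "'k \<Rightarrow> complex" where f: "\<And>x y. f (x + y) = f x + f y" "\<And>x y. f (x * y) = f x * f y"
    "f 1 = 1" "\<And>x. cmod (f x) = norm x" "range f = \<real> \<or> range f = UNIV"
    using ex_isometry_onto_real_or_complex[where ?'a = 'k] by blast
  have diff: "f (x - y) = f x - f y" for x y
    using f(1)[of "x - y" y] by simp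
  have inj: "x = y" if "f x = f y" for x y
    using diff[of x y] f(4)[of "x - y"] that by simp
  \<comment> \<open>The image of \<open>a\<close> has distance \<open>\<bar>a\<bar>\<close> from 0
    and \<open>\<bar>a - 1\<bar>\<close> from 1, and these two circles meet only at the point
    \<open>a\<close> of the real line.\<close>
  have f_real: "f (of_real a) = of_real a" for a
  proof -
    let ?z = "f (of_real a)"
    have "cmod ?z = \<bar>a\<bar>"
      by (simp add: f)
    then have "(Re ?z)\<^sup>2 + (Im ?z)\<^sup>2 = a\<^sup>2"
      by (metis cmod_power2 power2_abs)
    moreover have "cmod (?z - 1) = \<bar>a - 1\<bar>"
      using f(3) f(4)[of "of_real a - 1"] diff[of "of_real a" 1]
      by (metis norm_of_real of_real_1 of_real_diff)
    then have "(Re ?z - 1)\<^sup>2 + (Im ?z)\<^sup>2 = (a - 1)\<^sup>2"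
      using cmod_power2[of "?z - 1"] by simp
    ultimately have "Re ?z = a"
      by (simp add: power2_eq_square algebra_simps)
    then show ?thesis
      using \<open>(Re ?z)\<^sup>2 + (Im ?z)\<^sup>2 = a\<^sup>2\<close> by (simp add: complex_eq_iff)
  qed
  show thesis
  proof (cases "range f = UNIV")
    case True
    then obtain j where j: "f j = \<i>"
      by (metis surjD)
    have "f (- 1) = - 1"
      using f_real[of "- 1"] by simp
    then have "j * j = - 1"
      using j f by (intro inj) simp
    moreover have "norm j = 1"
      using f(4)[of j] j by simp
    moreover have "c = of_real (Re (f c)) + of_real (Im (f c)) * j" for c
      using f f_real j by (intro inj) (simp add: complex_eq_iff)
    moreover have "\<bar>a\<bar> \<le> norm (of_real a + of_real b * j)" for a b
    proof -
      have "f (of_real a + of_real b * j) = of_real a + of_real b * \<i>"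
        using f f_real j by simp
      then show ?thesis
        using abs_Re_le_cmod[of "f (of_real a + of_real b * j)"] f(4)[of "of_real a + of_real b * j"]
        by simp
    qed
    ultimately show ?thesis
      using complex by blast
  next
    case False
    have "\<exists>a. c = of_real a" for c :: 'k
    proof -
      have "f c \<in> \<real>"
        using f(5) False by blast
      then obtain a where "f c = of_real a"
        by (auto elim: Reals_cases)
      then show ?thesis
        using inj[of c "of_real a"] f_real by auto
    qed
    then show ?thesis
      using real by blast
  qed
qed

locale banach_space_over = normed_space_over smul
  for smul :: "'k::real_or_complex \<Rightarrow> 'v::banach \<Rightarrow> 'v"
begin

lemma dual_unit_ball_nonempty: "dual_unit_ball smul S \<noteq> {}"
proof -
  have "(\<lambda>_. 0) \<in> dual_unit_ball smul S"
    by (simp add: dual_unit_ball_def)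
  then show ?thesis by blast
qed

text \<open>The factor 2 spares the rotation argument that turns a real norming functional into a
  complex one of the same norm.\<close>

lemma ex_dual_norming: "\<exists>\<phi>\<in>dual_unit_ball smul S. norm y \<le> 2 * norm (\<phi> y)"
proof -
  obtain f where f: "linear f" "\<And>x. \<bar>f x\<bar> \<le> norm x" "f y = norm y"
    using ex_linear_norming by blast
  interpret f: linear f by fact
  show ?thesis
  proof (cases rule: real_or_complex_cases[where ?'k = 'k])
    case real
    have "of_real (f (smul c x)) = c * of_real (f x)" for c x
      using real[of c] by (auto simp: scale_of_real f.scale)
    then have "(\<lambda>x. of_real (f x)) \<in> dual_unit_ball smul S"
      by (simp add: dual_unit_ball_def f f.add)
    then show ?thesis
      using f by (intro bexI[of _ "\<lambda>x. of_real (f x)"]) auto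
  next
    case (complex j)
    \<comment> \<open>Half of the usual complexification of a real functional: the factor 1/2 makes
      the norm at most 1 by the triangle inequality alone.\<close>
    define \<phi> where "\<phi> x = (of_real (f x) - of_real (f (smul j x)) * j) / 2" for x
    have "\<phi> (smul c x) = c * \<phi> x" for c x
    proof -
      obtain a b where c: "c = of_real a + of_real b * j"
        using complex by blast
      have 1: "f (smul c x) = a * f x + b * f (smul j x)"
        by (simp add: c scale_left_distrib f.add scale_of_real f.scale flip: scale_scale)
      have "smul j (smul c x) = smul (of_real a * j + of_real b * (j * j)) x"
        by (simp add: c algebra_simps)
      also have "\<dots> = a *\<^sub>R smul j x - b *\<^sub>R x"
        by (simp add: complex(1) scale_left_diff_distrib scale_of_real flip: scale_of_real[of a "smul j x"])
      finally have "smul j (smul c x) = a *\<^sub>R smul j x - b *\<^sub>R x" .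
      then have 2: "f (smul j (smul c x)) = a * f (smul j x) - b * f x"
        by (simp add: f.diff f.scale)
      have jj: "j * (j * z) = - z" for z
        using complex(1) by (simp flip: mult.assoc)
      show ?thesis
        unfolding \<phi>_def 1 2 by (simp add: c algebra_simps jj)
    qed
    moreover have "norm (\<phi> x) \<le> norm x" for x
    proof -
      have "norm (\<phi> x) \<le> (norm (of_real (f x) :: 'k) + norm (of_real (f (smul j x)) * j)) / 2"
        unfolding \<phi>_def norm_divide by (intro divide_mono norm_triangle_ineq4) auto
      also have "\<dots> \<le> (norm x + norm (smul j x)) / 2"
        using f(2)[of x] f(2)[of "smul j x"] complex(2) by (simp add: norm_mult)
      finally show ?thesis
        using complex(2) by (simp add: norm_scale)
    qed
    ultimately have "\<phi> \<in> dual_unit_ball smul S"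
      by (simp add: dual_unit_ball_def) (simp add: \<phi>_def scale_right_distrib f.add algebra_simps add_divide_distrib diff_divide_distrib)
    \<comment> \<open>The real part of \<open>2 * \<phi> y\<close> is \<open>f y\<close>, which
      equals \<open>norm y\<close>.\<close>
    moreover have "norm y \<le> 2 * norm (\<phi> y)"
      using complex(4)[of "f y" "- f (smul j y)"] f(3) by (simp add: \<phi>_def norm_divide)
    ultimately show ?thesis
      by blast
  qed
qed

section \<open>Weak norms: finiteness, change of exponent, signed and weighted families\<close>

lemma bdd_above_weak_norm:
  assumes "q > 0" "\<And>k. k \<in> {1..n} \<Longrightarrow> x k \<in> S"
  shows "bdd_above ((\<lambda>\<phi>. ell q {1..n} (\<lambda>k. norm (\<phi> (x k)))) ` dual_unit_ball smul S)"
proof (rule bdd_aboveI2)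
  fix \<phi> assume "\<phi> \<in> dual_unit_ball smul S"
  then show "ell q {1..n} (\<lambda>k. norm (\<phi> (x k))) \<le> ell q {1..n} (\<lambda>k. norm (x k))"
    using assms by (intro ell_mono) (auto simp: dual_unit_ball_def)
qed

text \<open>A supremum of reals dominates its terms only if the set is bounded above. This is the
  case because functionals in the dual ball are contractions on \<open>S\<close>.\<close>

lemma ell_le_weak_norm:
  assumes "q > 0" "\<And>k. k \<in> {1..n} \<Longrightarrow> x k \<in> S" "\<phi> \<in> dual_unit_ball smul S"
  shows "ell q {1..n} (\<lambda>k. norm (\<phi> (x k))) \<le> weak_norm smul S q n x"
  unfolding weak_norm_def using bdd_above_weak_norm[of q n x S] assms
  by (intro cSUP_upper2[of _ _ \<phi>]) (auto simp: ell_def)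

lemma weak_norm_le:
  assumes "\<And>\<phi>. \<phi> \<in> dual_unit_ball smul S \<Longrightarrow> ell q {1..n} (\<lambda>k. norm (\<phi> (x k))) \<le> B"
  shows "weak_norm smul S q n x \<le> B"
  unfolding weak_norm_def using assms dual_unit_ball_nonempty by (intro cSUP_least) (auto simp: ell_def)

lemma weak_norm_nonneg:
  assumes "q > 0" "\<And>k. k \<in> {1..n} \<Longrightarrow> x k \<in> S"
  shows "0 \<le> weak_norm smul S q n x"
  using dual_unit_ball_nonempty ell_le_weak_norm[OF assms] ell_nonneg by (meson all_not_in_conv order_trans)

lemma weak_norm_le_card_max:
  assumes "s > 0" "q > 0" "n \<ge> 1" "\<And>k. k \<in> {1..n} \<Longrightarrow> x k \<in> S"
  shows "weak_norm smul S s n x \<le> real n powr (max 0 (1 / s - 1 / q)) * weak_norm smul S q n x"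
proof (rule weak_norm_le)
  fix \<phi> assume \<phi>: "\<phi> \<in> dual_unit_ball smul S"
  have "ell s {1..n} (\<lambda>k. norm (\<phi> (x k)))
      \<le> real (card {1..n}) powr (max 0 (1 / s - 1 / q)) * ell q {1..n} (\<lambda>k. norm (\<phi> (x k)))"
    using assms by (intro ell_le_card_max) auto
  also have "\<dots> \<le> real n powr (max 0 (1 / s - 1 / q)) * weak_norm smul S q n x"
    using ell_le_weak_norm[OF assms(2,4) \<phi>] by (simp add: mult_left_mono)
  finally show "ell s {1..n} (\<lambda>k. norm (\<phi> (x k)))
      \<le> real n powr (max 0 (1 / s - 1 / q)) * weak_norm smul S q n x" .
qed

lemma dual_unit_ball_scaleR:
  assumes "\<phi> \<in> dual_unit_ball smul S" "x \<in> S"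
  shows "\<phi> (a *\<^sub>R x) = of_real a * \<phi> x"
  using assms scale_of_real[of a x] unfolding dual_unit_ball_def by (metis (mono_tags, lifting) mem_Collect_eq)

lemma subspace_scaleR: "subspace S \<Longrightarrow> x \<in> S \<Longrightarrow> a *\<^sub>R x \<in> S"
  using subspace_scale[of S x "of_real a"] by (simp add: scale_of_real)

lemma subspace_sum_scaleR:
  "subspace S \<Longrightarrow> (\<And>k. k \<in> A \<Longrightarrow> x k \<in> S) \<Longrightarrow> (\<Sum>k\<in>A. a k *\<^sub>R x k) \<in> S"
  by (intro subspace_sum subspace_scaleR)

lemma dual_unit_ball_sum_scaleR:
  assumes "\<phi> \<in> dual_unit_ball smul S" "subspace S" "finite A" "\<And>k. k \<in> A \<Longrightarrow> x k \<in> S"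
  shows "\<phi> (\<Sum>k\<in>A. a k *\<^sub>R x k) = (\<Sum>k\<in>A. of_real (a k) * \<phi> (x k))"
  using assms(3,4)
proof induction
  case empty
  then show ?case
    using dual_unit_ball_scaleR[OF assms(1) subspace_0[OF assms(2)], of 0] by simp
next
  case (insert k A)
  have "\<phi> (a k *\<^sub>R x k + (\<Sum>k\<in>A. a k *\<^sub>R x k)) = \<phi> (a k *\<^sub>R x k) + \<phi> (\<Sum>k\<in>A. a k *\<^sub>R x k)"
    using assms(1) subspace_scaleR[OF assms(2), of "x k" "a k"]
      subspace_sum_scaleR[OF assms(2), of A x a] insert.prems
    by (simp add: dual_unit_ball_def)
  then show ?case
    using insert assms(1) by (simp add: dual_unit_ball_scaleR)
qed

text \<open>A functional that norms the sum up to the factor 2 can be moved inside it, where signs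
  of modulus at most 1 drop out. The bound is uniform in the signs, as the cotype argument
  demands.\<close>

lemma norm_signed_sum_le_weak_norm:
  assumes S: "subspace S" and x: "\<And>k. k \<in> {1..n} \<Longrightarrow> x k \<in> S" and \<epsilon>: "\<And>k. \<bar>\<epsilon> k\<bar> \<le> 1"
  shows "norm (\<Sum>k=1..n. \<epsilon> k *\<^sub>R x k) \<le> 2 * weak_norm smul S 1 n x"
proof -
  let ?y = "\<Sum>k=1..n. \<epsilon> k *\<^sub>R x k"
  obtain \<phi> where \<phi>: "\<phi> \<in> dual_unit_ball smul S" "norm ?y \<le> 2 * norm (\<phi> ?y)"
    using ex_dual_norming by blast
  have "norm (\<phi> ?y) \<le> (\<Sum>k=1..n. norm (of_real (\<epsilon> k) * \<phi> (x k)))"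
    using dual_unit_ball_sum_scaleR[OF \<phi>(1) S, of "{1..n}" x \<epsilon>] x by (simp add: norm_sum)
  also have "\<dots> \<le> (\<Sum>k=1..n. norm (\<phi> (x k)))"
    using \<epsilon> by (intro sum_mono) (simp add: norm_mult mult_left_le_one_le)
  also have "\<dots> \<le> weak_norm smul S 1 n x"
    using ell_le_weak_norm[of 1 n x S \<phi>] x \<phi> by (simp add: ell_def sum_nonneg)
  finally show ?thesis
    using \<phi>(2) by simp
qed

text \<open>Hoelder's inequality with the exponent \<open>s\<close> and its conjugate
  \<open>s / (s - 1)\<close>, for each functional separately.\<close>

lemma weak_norm_scaleR_le:
  assumes "s > 1" and a: "\<And>k. k \<in> {1..n} \<Longrightarrow> 0 \<le> a k" and x: "\<And>k. k \<in> {1..n} \<Longrightarrow> x k \<in> S"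
  shows "weak_norm smul S 1 n (\<lambda>k. a k *\<^sub>R x k) \<le> ell (s / (s - 1)) {1..n} a * weak_norm smul S s n x"
proof (rule weak_norm_le)
  fix \<phi> assume \<phi>: "\<phi> \<in> dual_unit_ball smul S"
  have "ell 1 {1..n} (\<lambda>k. norm (\<phi> (a k *\<^sub>R x k))) = (\<Sum>k=1..n. a k * norm (\<phi> (x k)))"
  proof -
    have "norm (\<phi> (a k *\<^sub>R x k)) powr 1 = a k * norm (\<phi> (x k))" if "k \<in> {1..n}" for k
      using \<phi> x[OF that] a[OF that] by (simp add: dual_unit_ball_scaleR norm_mult abs_mult)
    then have "(\<Sum>k=1..n. norm (\<phi> (a k *\<^sub>R x k)) powr 1) = (\<Sum>k=1..n. a k * norm (\<phi> (x k)))"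
      by (rule sum.cong[OF refl])
    moreover have "0 \<le> (\<Sum>k=1..n. a k * norm (\<phi> (x k)))"
      using a by (intro sum_nonneg mult_nonneg_nonneg) auto
    ultimately show ?thesis
      unfolding ell_def by simp
  qed
  also have "\<dots> \<le> ell (s / (s - 1)) {1..n} a * ell s {1..n} (\<lambda>k. norm (\<phi> (x k)))"
    using assms by (intro Holder_sum) (auto simp: field_simps)
  also have "\<dots> \<le> ell (s / (s - 1)) {1..n} a * weak_norm smul S s n x"
    using ell_le_weak_norm[of s n x S \<phi>] assms \<phi> by (intro mult_left_mono ell_nonneg) auto
  finally show "ell 1 {1..n} (\<lambda>k. norm (\<phi> (a k *\<^sub>R x k)))
      \<le> ell (s / (s - 1)) {1..n} a * weak_norm smul S s n x" .
qed

end

section \<open>Cotype\<close>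

text \<open>Jensen's inequality for a power. Young's inequality supplies the tangent line of the
  power at the mean, and integrating it over a probability space gives the claim. With the exponent
  \<open>\<rho> / 2\<close> it replaces the quadratic mean in the definition of cotype by a mean of
  order \<open>\<rho>\<close>.\<close>

lemma integral_powr_mono:
  fixes X :: "'a \<Rightarrow> real"
  assumes "finite_measure M" "measure M (space M) = 1" and \<alpha>: "\<alpha> \<ge> 1"
    and X: "\<And>x. X x \<ge> 0" "integrable M X" "integrable M (\<lambda>x. X x powr \<alpha>)"
  shows "(\<integral>x. X x \<partial>M) powr \<alpha> \<le> (\<integral>x. X x powr \<alpha> \<partial>M)"
proof (cases "\<alpha> = 1")
  case False
  interpret finite_measure M by fact
  define A where "A = (\<integral>x. X x \<partial>M)"
  have "A \<ge> 0"
    using X by (simp add: A_def)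
  have \<alpha>1: "\<alpha> > 1"
    using \<alpha> False by simp
  have "X x * A powr (\<alpha> - 1) \<le> X x powr \<alpha> / \<alpha> + A powr \<alpha> * (1 - 1 / \<alpha>)" for x
  proof -
    have "X x * A powr (\<alpha> - 1)
        \<le> X x powr \<alpha> / \<alpha> + (A powr (\<alpha> - 1)) powr (\<alpha> / (\<alpha> - 1)) / (\<alpha> / (\<alpha> - 1))"
      using \<alpha>1 X by (intro Youngs_inequality) (auto simp: field_simps)
    also have "(A powr (\<alpha> - 1)) powr (\<alpha> / (\<alpha> - 1)) = A powr \<alpha>"
      using \<alpha>1 by (simp add: powr_powr)
    finally show ?thesis
      using \<alpha>1 by (simp add: field_simps)
  qed
  then have "(\<integral>x. X x * A powr (\<alpha> - 1) \<partial>M) \<le> (\<integral>x. X x powr \<alpha> / \<alpha> + A powr \<alpha> * (1 - 1 / \<alpha>) \<partial>M)"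
    using X by (intro integral_mono) auto
  then have "A * A powr (\<alpha> - 1) \<le> (\<integral>x. X x powr \<alpha> \<partial>M) / \<alpha> + A powr \<alpha> * (1 - 1 / \<alpha>)"
    using X assms(2) by (simp add: A_def)
  moreover have "A * A powr (\<alpha> - 1) = A powr \<alpha>"
    using \<open>A \<ge> 0\<close> by (cases "A = 0") (auto simp: powr_diff)
  ultimately show ?thesis
    using \<alpha>1 by (simp add: A_def field_simps)
qed (use X in simp)

text \<open>Measurability of the Rademacher sums is derived through simple functions: these compose
  with any function and can be added even in a Banach space that is not separable.\<close>

lemma simple_function_rademacher: "simple_function lborel (rademacher k)"
proof (rule simple_function_borel_measurable)
  show "rademacher k \<in> borel_measurable lborel"
    unfolding rademacher_def by measurable
  have "rademacher k ` space lborel \<subseteq> {-1, 0, 1}"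
    by (auto simp: rademacher_def sgn_if)
  then show "finite (rademacher k ` space lborel)"
    using finite_subset by blast
qed

text \<open>The value 0 occurs where the sine vanishes. Signs are therefore only required to have
  modulus at most 1 throughout.\<close>

lemma abs_rademacher_le_1: "\<bar>rademacher k u\<bar> \<le> 1"
  by (simp add: rademacher_def sgn_if)

text \<open>Averaging over the signs before summing over \<open>K\<close> keeps the right-hand side a bound that is
  uniform in the signs, so that cotype can be applied to one variable of an operator after the other.\<close>

lemma has_cotype_sum_le:
  assumes "has_cotype TYPE('w::banach) (ereal \<rho>)"
  obtains C where "C \<ge> 0"
    "\<And>(n :: nat) (K :: 'i set) y B. \<lbrakk>n \<ge> 1; finite K;
      \<And>\<epsilon>. (\<And>l. \<bar>\<epsilon> l\<bar> \<le> 1) \<Longrightarrow> (\<Sum>\<kappa>\<in>K. norm (\<Sum>l=1..n. \<epsilon> l *\<^sub>R y \<kappa> l :: 'w) powr \<rho>) \<le> B\<rbrakk>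
      \<Longrightarrow> (\<Sum>\<kappa>\<in>K. \<Sum>l=1..n. norm (y \<kappa> l) powr \<rho>) \<le> C * B"
proof -
  have \<rho>: "\<rho> \<ge> 2"
    using assms by (simp add: has_cotype_def)
  define M where "M = restrict_space lborel {0..1::real}"
  obtain C where C: "C \<ge> 0" "\<And>n x. n \<ge> 1 \<Longrightarrow> (\<Sum>k=1..n. norm (x k :: 'w) powr \<rho>) powr (1 / \<rho>)
      \<le> C * sqrt (LINT u:{0..1}|lborel. (norm (\<Sum>k=1..n. rademacher k u *\<^sub>R x k))\<^sup>2)"
    using assms by (auto simp: has_cotype_def)
  have M1: "measure M (space M) = 1" and "finite_measure M"
    by (auto simp: M_def measure_restrict_space space_restrict_space emeasure_restrict_space intro!: finite_measureI)
  interpret finite_measure M by fact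
  define N where "N n x u = norm (\<Sum>l=1..n. rademacher l u *\<^sub>R (x l :: 'w))" for n x u
  have N_nonneg: "N n x u \<ge> 0" for n x u
    by (simp add: N_def)
  have meas: "N n x \<in> borel_measurable M" for n x
  proof -
    have "simple_function lborel (\<lambda>u. rademacher l u *\<^sub>R x l)" for l
      by (rule simple_function_compose1[OF simple_function_rademacher])
    then have "simple_function lborel (\<lambda>u. \<Sum>l=1..n. rademacher l u *\<^sub>R x l)"
      by (intro simple_function_sum)
    then have "simple_function lborel (N n x)"
      unfolding N_def by (rule simple_function_compose1)
    then show ?thesis
      unfolding M_def by (intro measurable_restrict_space1 borel_measurable_simple_function)
  qed
  have N_le: "N n x u \<le> (\<Sum>l=1..n. norm (x l))" for n x u
    unfolding N_def using abs_rademacher_le_1 by (intro sum_norm_le) (simp add: mult_left_le_one_le)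
  have int: "integrable M (\<lambda>u. N n x u powr \<rho>)" for n x
  proof (rule integrable_const_bound)
    show "AE u in M. norm (N n x u powr \<rho>) \<le> (\<Sum>l=1..n. norm (x l)) powr \<rho>"
      using N_le N_nonneg \<rho> by (auto intro!: powr_mono2)
  qed (use meas in measurable)
  have int2: "integrable M (\<lambda>u. (N n x u)\<^sup>2)" for n x
  proof (rule integrable_const_bound)
    show "AE u in M. norm ((N n x u)\<^sup>2) \<le> (\<Sum>l=1..n. norm (x l))\<^sup>2"
      using N_le N_nonneg by (auto intro!: power_mono)
  qed (use meas in measurable)
  \<comment> \<open>The cotype inequality raised to the power \<open>\<rho>\<close>. Since
    \<open>\<rho> / 2 \<ge> 1\<close>, the quadratic mean may be replaced by an integral of
    \<open>\<rho>\<close>-th powers, which can be summed over \<open>K\<close> under the integral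
    sign.\<close>
  have single: "(\<Sum>l=1..n. norm (x l) powr \<rho>) \<le> C powr \<rho> * (\<integral>u. N n x u powr \<rho> \<partial>M)" if "n \<ge> 1" for n x
  proof -
    let ?I = "\<integral>u. (N n x u)\<^sup>2 \<partial>M"
    have sq: "(N n x u)\<^sup>2 powr (\<rho> / 2) = N n x u powr \<rho>" for u
      using N_nonneg[of n x u] by (cases "N n x u = 0") (auto simp: powr_powr simp flip: powr_numeral)
    have "(\<Sum>l=1..n. norm (x l) powr \<rho>) powr (1 / \<rho>) \<le> C * sqrt ?I"
      using C(2)[OF that, of x]
      by (simp add: M_def integral_restrict_space set_lebesgue_integral_def N_def)
    then have "((\<Sum>l=1..n. norm (x l) powr \<rho>) powr (1 / \<rho>)) powr \<rho> \<le> (C * sqrt ?I) powr \<rho>"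
      using \<rho> by (intro powr_mono2) auto
    then have "(\<Sum>l=1..n. norm (x l) powr \<rho>) \<le> C powr \<rho> * (?I powr (\<rho> / 2))"
      using C(1) \<rho> by (simp add: powr_powr sum_nonneg powr_mult powr_half_sqrt[symmetric])
    also have "\<dots> \<le> C powr \<rho> * (\<integral>u. (N n x u)\<^sup>2 powr (\<rho> / 2) \<partial>M)"
      using \<rho> int int2 by (intro mult_left_mono integral_powr_mono[OF _ M1]) (auto simp: sq finite_measure_axioms)
    finally show ?thesis
      by (simp add: sq)
  qed
  show ?thesis
  proof (rule that[of "C powr \<rho>"])
    fix n :: nat and K :: "'i set" and y :: "'i \<Rightarrow> nat \<Rightarrow> 'w" and B :: real
    assume n: "1 \<le> n" and K: "finite K"
      and B: "\<And>\<epsilon>. (\<And>l. \<bar>\<epsilon> l\<bar> \<le> 1) \<Longrightarrow> (\<Sum>\<kappa>\<in>K. norm (\<Sum>l=1..n. \<epsilon> l *\<^sub>R y \<kappa> l) powr \<rho>) \<le> B"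
    have "(\<Sum>\<kappa>\<in>K. \<Sum>l=1..n. norm (y \<kappa> l) powr \<rho>) \<le> (\<Sum>\<kappa>\<in>K. C powr \<rho> * (\<integral>u. N n (y \<kappa>) u powr \<rho> \<partial>M))"
      using n by (intro sum_mono single)
    also have "\<dots> = C powr \<rho> * (\<integral>u. (\<Sum>\<kappa>\<in>K. N n (y \<kappa>) u powr \<rho>) \<partial>M)"
      using int by (simp add: sum_distrib_left)
    also have "\<dots> \<le> C powr \<rho> * (\<integral>u. B \<partial>M)"
    proof (intro mult_left_mono integral_mono)
      \<comment> \<open>For fixed \<open>u\<close> the Rademacher values are admissible signs, so
        the hypothesis bounds the integrand pointwise.\<close>
      show "(\<Sum>\<kappa>\<in>K. N n (y \<kappa>) u powr \<rho>) \<le> B" for u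
        using B[of "\<lambda>l. rademacher l u"] abs_rademacher_le_1 by (simp add: N_def)
    qed (use int in auto)
    also have "(\<integral>u. B \<partial>M) = B"
      by (simp add: M1)
    finally show "(\<Sum>\<kappa>\<in>K. \<Sum>l=1..n. norm (y \<kappa> l) powr \<rho>) \<le> C powr \<rho> * B" .
  qed simp
qed

section \<open>Multilinear operators\<close>

locale multilinear_operator =
  E: banach_space_over scaleE + F: normed_space_over scaleF
  for scaleE :: "'k::real_or_complex \<Rightarrow> 'v::banach \<Rightarrow> 'v"
    and scaleF :: "'k \<Rightarrow> 'w::banach \<Rightarrow> 'w" +
  fixes m :: nat and E :: "nat \<Rightarrow> 'v set" and T :: "(nat \<Rightarrow> 'v) \<Rightarrow> 'w"
  assumes E_subspace: "\<And>i. i \<in> {1..m} \<Longrightarrow> E.subspace (E i)"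
    and T_mem: "T \<in> continuous_multilinear scaleE scaleF m E"
begin

lemma T_add:
  "\<lbrakk>x \<in> (\<Pi>\<^sub>E i\<in>{1..m}. E i); i \<in> {1..m}; u \<in> E i; v \<in> E i\<rbrakk>
    \<Longrightarrow> T (x(i := u + v)) = T (x(i := u)) + T (x(i := v))"
  using T_mem by (simp add: continuous_multilinear_def)

lemma T_scaleR:
  assumes "x \<in> (\<Pi>\<^sub>E i\<in>{1..m}. E i)" "i \<in> {1..m}" "u \<in> E i"
  shows "T (x(i := a *\<^sub>R u)) = a *\<^sub>R T (x(i := u))"
proof -
  have "T (x(i := scaleE (of_real a) u)) = scaleF (of_real a) (T (x(i := u)))"
    using T_mem assms by (simp add: continuous_multilinear_def)
  then show ?thesis
    by (simp add: E.scale_of_real F.scale_of_real)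
qed

lemma T_sum_scaleR:
  assumes x: "x \<in> (\<Pi>\<^sub>E i\<in>{1..m}. E i)" "i \<in> {1..m}" and A: "finite A" "\<And>l. l \<in> A \<Longrightarrow> u l \<in> E i"
  shows "T (x(i := (\<Sum>l\<in>A. a l *\<^sub>R u l))) = (\<Sum>l\<in>A. a l *\<^sub>R T (x(i := u l)))"
proof -
  define U where "U v = T (x(i := v))" for v
  have add: "U (v + w) = U v + U w" if "v \<in> E i" "w \<in> E i" for v w
    unfolding U_def by (rule T_add[OF x that])
  have scale: "U (c *\<^sub>R v) = c *\<^sub>R U v" if "v \<in> E i" for v c
    unfolding U_def by (rule T_scaleR[OF x that])
  note S = E_subspace[OF x(2)]
  have "U (\<Sum>l\<in>A. a l *\<^sub>R u l) = (\<Sum>l\<in>A. a l *\<^sub>R U (u l))"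
    using A
  proof induction
    case empty
    then show ?case
      using scale[OF E.subspace_0[OF S], of 0] by simp
  next
    case (insert l A)
    have "U (a l *\<^sub>R u l + (\<Sum>l\<in>A. a l *\<^sub>R u l)) = U (a l *\<^sub>R u l) + U (\<Sum>l\<in>A. a l *\<^sub>R u l)"
      using insert.prems by (intro add E.subspace_scaleR[OF S] E.subspace_sum_scaleR[OF S]) auto
    then show ?case
      using insert by (simp add: scale)
  qed
  then show ?thesis
    by (simp add: U_def)
qed

text \<open>Serves to bring all coordinates of a tuple to a prescribed norm at once; the induction
  rescales one coordinate after the other.\<close>

lemma T_scaleR_all:
  assumes x: "x \<in> (\<Pi>\<^sub>E i\<in>{1..m}. E i)" and J: "finite J" "J \<subseteq> {1..m}"
  shows "T (\<lambda>i. if i \<in> J then a i *\<^sub>R x i else x i) = (\<Prod>i\<in>J. a i) *\<^sub>R T x"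
  using J
proof induction
  case (insert j J)
  let ?x = "\<lambda>i. if i \<in> J then a i *\<^sub>R x i else x i"
  have mem: "?x \<in> (\<Pi>\<^sub>E i\<in>{1..m}. E i)"
    using x insert.prems E_subspace by (auto simp: PiE_iff extensional_def intro!: E.subspace_scaleR)
  have eq: "(\<lambda>i. if i \<in> insert j J then a i *\<^sub>R x i else x i) = ?x(j := a j *\<^sub>R x j)" "?x(j := x j) = ?x"
    using insert.hyps by auto
  have "T (?x(j := a j *\<^sub>R x j)) = a j *\<^sub>R T (?x(j := x j))"
    using insert.prems x by (intro T_scaleR[OF mem]) (auto simp: PiE_iff)
  then show ?case
    unfolding eq using insert by simp
qed simp

text \<open>Continuity at the zero tuple bounds \<open>T\<close> on a small box; rescaling every
  coordinate to the size of the box turns this into the product bound.\<close>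

lemma ex_norm_bound: "\<exists>M\<ge>0. \<forall>x\<in>(\<Pi>\<^sub>E i\<in>{1..m}. E i). norm (T x) \<le> M * (\<Prod>i=1..m. norm (x i))"
proof -
  let ?P = "\<Pi>\<^sub>E i\<in>{1..m}. E i"
  \<comment> \<open>Outside \<open>{1..m}\<close> this tuple is \<open>undefined\<close>, as are all
    members of the extensional product, so those coordinates agree automatically.\<close>
  define z where "z = (\<lambda>i\<in>{1..m}. 0 :: 'v)"
  have z: "z \<in> ?P"
    using E_subspace E.subspace_0 by (auto simp: z_def)
  have "continuous_on ?P T"
    using T_mem by (simp add: continuous_multilinear_def)
  then obtain U where U: "open U" "U \<inter> ?P = T -` ball (T z) 1 \<inter> ?P"
    unfolding continuous_on_open_invariant by (metis open_ball)
  then have "openin (product_topology (\<lambda>i. euclidean) UNIV) U" "z \<in> U"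
    using z by (auto simp: open_fun_def)
  then obtain X where X: "z \<in> (\<Pi>\<^sub>E i\<in>UNIV. X i)" "\<And>i. open (X i)" "(\<Pi>\<^sub>E i\<in>UNIV. X i) \<subseteq> U"
    using product_topology_open_contains_basis[of "\<lambda>i. euclidean" UNIV U z] by auto
  have "\<exists>d>0. ball 0 d \<subseteq> X i" if "i \<in> {1..m}" for i
    using X(1) X(2)[of i] that by (auto simp: z_def PiE_iff open_contains_ball dest: spec[of _ i])
  then obtain d where d: "\<And>i. i \<in> {1..m} \<Longrightarrow> d i > 0 \<and> ball 0 (d i) \<subseteq> X i"
    by metis
  \<comment> \<open>The element 1 keeps the set nonempty for \<open>m = 0\<close>; halving places
    the closed ball of radius \<open>\<delta>\<close> inside each open one.\<close>
  define \<delta> where "\<delta> = Min (insert 1 (d ` {1..m})) / 2"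
  have \<delta>: "\<delta> > 0" "\<And>i. i \<in> {1..m} \<Longrightarrow> \<delta> < d i"
  proof -
    show "\<delta> > 0"
      using d by (auto simp: \<delta>_def)
    fix i assume "i \<in> {1..m}"
    then have "Min (insert 1 (d ` {1..m})) \<le> d i"
      by (intro Min_le) auto
    then have "2 * \<delta> \<le> d i"
      by (simp add: \<delta>_def)
    then show "\<delta> < d i"
      using \<open>\<delta> > 0\<close> by simp
  qed
  define K where "K = 1 + norm (T z)"
  have small: "norm (T x) \<le> K" if x: "x \<in> ?P" "\<And>i. i \<in> {1..m} \<Longrightarrow> norm (x i) \<le> \<delta>" for x
  proof -
    have "x i \<in> X i" for i
    proof (cases "i \<in> {1..m}")
      case True
      then have "x i \<in> ball 0 (d i)"
        using x(2)[OF True] \<delta>(2)[OF True] by simp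
      then show ?thesis
        using d[OF True] by blast
    next
      case False
      then have "x i = z i"
        using x(1) by (auto simp: z_def PiE_iff extensional_def)
      then show ?thesis
        using X(1) by (auto simp: PiE_iff)
    qed
    then have "x \<in> U"
      using X(3) by (auto simp: PiE_iff)
    then have "dist (T z) (T x) < 1"
      using U(2) x(1) by auto
    then show ?thesis
      using norm_triangle_ineq2[of "T x" "T z"] by (simp add: K_def dist_norm norm_minus_commute)
  qed
  show ?thesis
  proof (intro exI[of _ "K * (1 / \<delta>) ^ m"] conjI ballI)
    show "0 \<le> K * (1 / \<delta>) ^ m"
      using \<delta>(1) by (simp add: K_def)
    fix x assume x: "x \<in> ?P"
    show "norm (T x) \<le> K * (1 / \<delta>) ^ m * (\<Prod>i=1..m. norm (x i))"
    proof (cases "\<exists>i\<in>{1..m}. x i = 0")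
      \<comment> \<open>A zero coordinate cannot be rescaled, but then \<open>T x = 0\<close> by
        homogeneity.\<close>
      case True
      then obtain i where i: "i \<in> {1..m}" "x i = 0" by blast
      have "x i \<in> E i"
        using x i(1) by (rule PiE_mem)
      then have "T (x(i := 0 *\<^sub>R x i)) = 0"
        using T_scaleR[OF x i(1), of "x i" 0] by (simp only: scaleR_zero_left)
      then have "T x = 0"
        using i by (simp add: fun_upd_idem)
      moreover have "(\<Prod>i=1..m. norm (x i)) = 0"
        using i by (intro prod_zero) auto
      ultimately show ?thesis
        by (simp only: norm_zero mult_zero_right order_refl)
    next
      case False
      define a where "a i = \<delta> / norm (x i)" for i
      let ?x = "\<lambda>i. if i \<in> {1..m} then a i *\<^sub>R x i else x i"
      have "norm (T ?x) \<le> K"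
      proof (rule small)
        show "?x \<in> ?P"
          using x E_subspace by (auto simp: PiE_iff extensional_def intro!: E.subspace_scaleR)
        show "norm (?x i) \<le> \<delta>" if "i \<in> {1..m}" for i
          using that False \<delta>(1) by (simp add: a_def)
      qed
      moreover have "T ?x = (\<Prod>i=1..m. a i) *\<^sub>R T x"
        by (rule T_scaleR_all[OF x]) auto
      moreover have "0 \<le> (\<Prod>i=1..m. a i)"
        using \<delta>(1) by (intro prod_nonneg) (auto simp: a_def)
      ultimately have "(\<Prod>i=1..m. \<delta> / norm (x i)) * norm (T x) \<le> K"
        by (simp only: norm_scaleR abs_of_nonneg) (simp add: a_def)
      moreover have "(\<Prod>i=1..m. norm (x i)) > 0"
        using False by (intro prod_pos) auto
      ultimately show ?thesis
        using \<delta>(1) by (simp add: prod_dividef field_simps)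
    qed
  qed
qed

section \<open>Multiple summing operators and their exponents\<close>

definition T_ell :: "real \<Rightarrow> nat \<Rightarrow> (nat \<Rightarrow> nat \<Rightarrow> 'v) \<Rightarrow> real" where
  "T_ell p n x = ell p ({1..m} \<rightarrow>\<^sub>E {1..n}) (\<lambda>k. norm (T (\<lambda>i\<in>{1..m}. x i (k i))))"

text \<open>Each coordinate has its own weak exponent, because these are raised from 1 to
  \<open>s\<close> one coordinate at a time.\<close>

definition multiple_summing :: "real \<Rightarrow> (nat \<Rightarrow> real) \<Rightarrow> bool" where
  "multiple_summing p q \<longleftrightarrow> (\<exists>C\<ge>0. \<forall>n\<ge>1. \<forall>x. (\<forall>i\<in>{1..m}. \<forall>k\<in>{1..n}. x i k \<in> E i) \<longrightarrow>
     T_ell p n x \<le> C * (\<Prod>i=1..m. weak_norm scaleE (E i) (q i) n (x i)))"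

lemma cotype_block:
  fixes x :: "nat \<Rightarrow> nat \<Rightarrow> 'v" and C M \<rho> :: real
  assumes C: "C \<ge> 0" "\<And>(K :: (nat \<Rightarrow> nat) set) y B. \<lbrakk>finite K;
      \<And>\<epsilon>. (\<And>l. \<bar>\<epsilon> l\<bar> \<le> 1) \<Longrightarrow> (\<Sum>\<kappa>\<in>K. norm (\<Sum>l=1..n. \<epsilon> l *\<^sub>R y \<kappa> l :: 'w) powr \<rho>) \<le> B\<rbrakk>
      \<Longrightarrow> (\<Sum>\<kappa>\<in>K. \<Sum>l=1..n. norm (y \<kappa> l) powr \<rho>) \<le> C * B"
    and M: "M \<ge> 0" "\<And>x. x \<in> (\<Pi>\<^sub>E i\<in>{1..m}. E i) \<Longrightarrow> norm (T x) \<le> M * (\<Prod>i=1..m. norm (x i))"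
    and "\<rho> > 0" and x: "\<And>i k. i \<in> {1..m} \<Longrightarrow> k \<in> {1..n} \<Longrightarrow> x i k \<in> E i"
    and W: "\<And>i \<epsilon>. i \<in> {1..m} \<Longrightarrow> (\<And>l. \<bar>\<epsilon> l\<bar> \<le> 1) \<Longrightarrow> norm (\<Sum>l=1..n. \<epsilon> l *\<^sub>R x i l) \<le> W i"
    and J: "finite J" "J \<subseteq> {1..m}" and z: "z \<in> (\<Pi>\<^sub>E i\<in>{1..m}. E i)"
  shows "(\<Sum>k\<in>J \<rightarrow>\<^sub>E {1..n}. norm (T (\<lambda>i\<in>{1..m}. if i \<in> J then x i (k i) else z i)) powr \<rho>)
      \<le> C ^ card J * (M * (\<Prod>i=1..m. if i \<in> J then W i else norm (z i))) powr \<rho>"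
  using J z
proof (induction arbitrary: z)
  case empty
  have "(\<lambda>i\<in>{1..m}. z i) = z"
    using empty by (auto simp: PiE_iff extensional_def)
  then show ?case
    using M(2)[OF empty(2)] \<open>\<rho> > 0\<close> by (simp add: powr_mono2)
next
  case (insert j J)
  have j: "j \<in> {1..m}" "j \<notin> J"
    using insert by auto
  let ?b = "\<lambda>z k. \<lambda>i\<in>{1..m}. if i \<in> J then x i (k i) else z i"
  let ?B = "C ^ card J * (M * (\<Prod>i=1..m. if i \<in> insert j J then W i else norm (z i))) powr \<rho>"
  have b: "?b z k \<in> (\<Pi>\<^sub>E i\<in>{1..m}. E i)" if "k \<in> J \<rightarrow>\<^sub>E {1..n}" "z \<in> (\<Pi>\<^sub>E i\<in>{1..m}. E i)" for z k
    using that x by (auto simp: PiE_iff)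
  have "(\<Sum>k\<in>insert j J \<rightarrow>\<^sub>E {1..n}. norm (T (\<lambda>i\<in>{1..m}. if i \<in> insert j J then x i (k i) else z i)) powr \<rho>)
      = (\<Sum>(l, k)\<in>{1..n} \<times> (J \<rightarrow>\<^sub>E {1..n}). norm (T ((?b z k)(j := x j l))) powr \<rho>)"
    unfolding PiE_insert_eq using j
    by (subst sum.reindex[OF inj_combinator]) (auto simp: case_prod_beta fun_eq_iff intro!: sum.cong arg_cong[where f = "\<lambda>y. norm (T y) powr \<rho>"])
  also have "\<dots> = (\<Sum>k\<in>J \<rightarrow>\<^sub>E {1..n}. \<Sum>l=1..n. norm (T ((?b z k)(j := x j l))) powr \<rho>)"
    unfolding sum.cartesian_product[symmetric] by (rule sum.swap)
  also have "\<dots> \<le> C * ?B"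
  proof (rule C(2))
    show "finite (J \<rightarrow>\<^sub>E {1..n})"
      using insert.hyps by (intro finite_PiE) auto
    fix \<epsilon> :: "nat \<Rightarrow> real" assume \<epsilon>: "\<And>l. \<bar>\<epsilon> l\<bar> \<le> 1"
    let ?v = "\<Sum>l=1..n. \<epsilon> l *\<^sub>R x j l"
    have v: "?v \<in> E j"
      using x j by (intro E.subspace_sum_scaleR E_subspace) auto
    then have z': "z(j := ?v) \<in> (\<Pi>\<^sub>E i\<in>{1..m}. E i)"
      using insert.prems j by (auto simp: PiE_iff extensional_def)
    have "(\<Sum>l=1..n. \<epsilon> l *\<^sub>R T ((?b z k)(j := x j l))) = T (?b (z(j := ?v)) k)"
      if "k \<in> J \<rightarrow>\<^sub>E {1..n}" for k
    proof -
      have "(\<Sum>l=1..n. \<epsilon> l *\<^sub>R T ((?b z k)(j := x j l))) = T ((?b z k)(j := ?v))"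
        using x j by (intro T_sum_scaleR[OF b[OF that insert.prems(2)] j(1), symmetric]) auto
      also have "(?b z k)(j := ?v) = ?b (z(j := ?v)) k"
        using j by (auto simp: fun_eq_iff)
      finally show ?thesis .
    qed
    then have "(\<Sum>k\<in>J \<rightarrow>\<^sub>E {1..n}. norm (\<Sum>l=1..n. \<epsilon> l *\<^sub>R T ((?b z k)(j := x j l))) powr \<rho>)
        = (\<Sum>k\<in>J \<rightarrow>\<^sub>E {1..n}. norm (T (?b (z(j := ?v)) k)) powr \<rho>)"
      by (intro sum.cong) auto
    also have "\<dots> \<le> C ^ card J * (M * (\<Prod>i=1..m. if i \<in> J then W i else norm ((z(j := ?v)) i))) powr \<rho>"
      using insert.prems z' by (intro insert.IH) auto
    \<comment> \<open>Replacing the norm of the signed sum by \<open>W j\<close> removes the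
      dependence on the signs.\<close>
    also have "\<dots> \<le> ?B"
    proof -
      have W0: "0 \<le> W i" if "i \<in> {1..m}" for i
        using W[OF that, of "\<lambda>_. 0"] by simp
      have "(\<Prod>i=1..m. if i \<in> J then W i else norm ((z(j := ?v)) i))
          \<le> (\<Prod>i=1..m. if i \<in> insert j J then W i else norm (z i))"
        using W0 W[OF j(1) \<epsilon>] by (intro prod_mono) auto
      moreover have "0 \<le> (\<Prod>i=1..m. if i \<in> J then W i else norm ((z(j := ?v)) i))"
        using W0 by (intro prod_nonneg) auto
      ultimately show ?thesis
        using C(1) M(1) \<open>\<rho> > 0\<close> by (intro mult_left_mono powr_mono2) auto
    qed
    finally show "(\<Sum>k\<in>J \<rightarrow>\<^sub>E {1..n}. norm (\<Sum>l=1..n. \<epsilon> l *\<^sub>R T ((?b z k)(j := x j l))) powr \<rho>) \<le> ?B" .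
  qed
  also have "\<dots> = C ^ card (insert j J) * (M * (\<Prod>i=1..m. if i \<in> insert j J then W i else norm (z i))) powr \<rho>"
    using insert.hyps by simp
  finally show ?case .
qed

text \<open>The instance of \<open>cotype_block\<close> in which all coordinates are summed and
  \<open>W i\<close> is twice the weak 1-norm.\<close>

lemma multiple_summing_cotype:
  assumes cot: "has_cotype TYPE('w) (ereal \<rho>)"
  shows "multiple_summing \<rho> (\<lambda>_. 1)"
proof -
  have \<rho>: "\<rho> > 0"
    using cot by (simp add: has_cotype_def)
  obtain M where M: "M \<ge> 0" "\<And>x. x \<in> (\<Pi>\<^sub>E i\<in>{1..m}. E i) \<Longrightarrow> norm (T x) \<le> M * (\<Prod>i=1..m. norm (x i))"
    using ex_norm_bound by blast
  obtain C where C: "C \<ge> 0" "\<And>(n :: nat) (K :: (nat \<Rightarrow> nat) set) y B. \<lbrakk>n \<ge> 1; finite K;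
      \<And>\<epsilon>. (\<And>l. \<bar>\<epsilon> l\<bar> \<le> 1) \<Longrightarrow> (\<Sum>\<kappa>\<in>K. norm (\<Sum>l=1..n. \<epsilon> l *\<^sub>R y \<kappa> l :: 'w) powr \<rho>) \<le> B\<rbrakk>
      \<Longrightarrow> (\<Sum>\<kappa>\<in>K. \<Sum>l=1..n. norm (y \<kappa> l) powr \<rho>) \<le> C * B"
    by (rule has_cotype_sum_le[where ?'i = "nat \<Rightarrow> nat", OF cot]) blast
  show ?thesis
    unfolding multiple_summing_def
  proof (intro exI[of _ "(C ^ m) powr (1 / \<rho>) * (M * 2 ^ m)"] conjI allI impI)
    show "0 \<le> (C ^ m) powr (1 / \<rho>) * (M * 2 ^ m)"
      using M by simp
    fix n :: nat and x :: "nat \<Rightarrow> nat \<Rightarrow> 'v"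
    assume n: "1 \<le> n" and x: "\<forall>i\<in>{1..m}. \<forall>k\<in>{1..n}. x i k \<in> E i"
    let ?w = "\<lambda>i. weak_norm scaleE (E i) 1 n (x i)"
    let ?N = "\<lambda>k. norm (T (\<lambda>i\<in>{1..m}. x i (k i)))"
    define z where "z = (\<lambda>i\<in>{1..m}. 0 :: 'v)"
    have z: "z \<in> (\<Pi>\<^sub>E i\<in>{1..m}. E i)"
      using E_subspace E.subspace_0 by (auto simp: z_def)
    have "(\<Sum>k\<in>{1..m} \<rightarrow>\<^sub>E {1..n}. norm (T (\<lambda>i\<in>{1..m}. if i \<in> {1..m} then x i (k i) else z i)) powr \<rho>)
        \<le> C ^ card {1..m} * (M * (\<Prod>i=1..m. if i \<in> {1..m} then 2 * ?w i else norm (z i))) powr \<rho>"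
      using x E_subspace
      by (intro cotype_block[OF C(1) C(2)[OF n] M \<rho> _ _ _ _ z] E.norm_signed_sum_le_weak_norm) auto
    also have "(\<Prod>i=1..m. if i \<in> {1..m} then 2 * ?w i else norm (z i)) = 2 ^ m * (\<Prod>i=1..m. ?w i)"
      by (simp add: prod.distrib)
    also have "(\<Sum>k\<in>{1..m} \<rightarrow>\<^sub>E {1..n}. norm (T (\<lambda>i\<in>{1..m}. if i \<in> {1..m} then x i (k i) else z i)) powr \<rho>)
        = (\<Sum>k\<in>{1..m} \<rightarrow>\<^sub>E {1..n}. ?N k powr \<rho>)"
      by (intro sum.cong refl arg_cong[where f = "\<lambda>y. norm (T y) powr \<rho>"]) auto
    finally have "(\<Sum>k\<in>{1..m} \<rightarrow>\<^sub>E {1..n}. ?N k powr \<rho>)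
        \<le> C ^ m * (M * (2 ^ m * (\<Prod>i=1..m. ?w i))) powr \<rho>" by simp
    then have "T_ell \<rho> n x \<le> (C ^ m * (M * (2 ^ m * (\<Prod>i=1..m. ?w i))) powr \<rho>) powr (1 / \<rho>)"
      unfolding T_ell_def ell_def using \<rho> by (intro powr_mono2 sum_nonneg) auto
    also have "\<dots> = (C ^ m) powr (1 / \<rho>) * (M * (2 ^ m * (\<Prod>i=1..m. ?w i)))"
    proof -
      have "0 \<le> (\<Prod>i=1..m. ?w i)"
        using x by (intro prod_nonneg E.weak_norm_nonneg) auto
      then show ?thesis
        using C(1) M(1) \<rho> by (simp add: powr_mult powr_powr)
    qed
    finally show "T_ell \<rho> n x \<le> (C ^ m) powr (1 / \<rho>) * (M * 2 ^ m) * (\<Prod>i=1..m. ?w i)"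
      by (simp add: mult_ac)
  qed
qed

text \<open>Testing the hypothesis on \<open>a k *\<^sub>R x j k\<close> with the weights \<open>a\<close> that are extremal in
  Hoelder's inequality trades the weak exponent 1 of the \<open>j\<close>-th variable for \<open>s\<close>.\<close>

lemma multiple_summing_step:
  assumes ms: "multiple_summing p q" and j: "j \<in> {1..m}" "q j = 1" and q: "\<And>i. i \<in> {1..m} \<Longrightarrow> q i > 0"
    and s: "s > 1" and p: "p > 0" "p' > 0" "1 / p' = 1 / p - (1 - 1 / s)"
  shows "multiple_summing p' (q(j := s))"
proof -
  obtain C where C: "C \<ge> 0" "\<And>n x. \<lbrakk>n \<ge> 1; \<And>i k. i \<in> {1..m} \<Longrightarrow> k \<in> {1..n} \<Longrightarrow> x i k \<in> E i\<rbrakk>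
     \<Longrightarrow> T_ell p n x \<le> C * (\<Prod>i=1..m. weak_norm scaleE (E i) (q i) n (x i))"
    using ms unfolding multiple_summing_def by auto
  \<comment> \<open>The reciprocal of the conjugate exponent of \<open>s\<close>, and the loss in
    the reciprocal of the strong exponent.\<close>
  define \<kappa> where "\<kappa> = 1 - 1 / s"
  have \<kappa>: "\<kappa> > 0" "1 / p' = 1 / p - \<kappa>" "s / (s - 1) = 1 / \<kappa>"
    using s p by (auto simp: \<kappa>_def field_simps)
  have "1 / p' \<le> 1 / p"
    using \<kappa> by simp
  then have pp': "p \<le> p'"
    using p divide_strict_left_mono[of p' p 1] by fastforce
  \<comment> \<open>Thanks to this identity the weights turn \<open>S l powr p\<close> into
    \<open>S l powr p'\<close>.\<close>
  have exps: "p' * \<kappa> * p + p = p'"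
  proof -
    have "p = p' * p * (1 / p')"
      using p(1,2) by simp
    also have "\<dots> = p' - p' * \<kappa> * p"
      unfolding \<kappa>(2) using p(1,2) by (simp add: right_diff_distrib)
    finally show ?thesis
      by simp
  qed
  show ?thesis
    unfolding multiple_summing_def
  proof (intro exI[of _ C] conjI allI impI)
    fix n :: nat and x :: "nat \<Rightarrow> nat \<Rightarrow> 'v"
    assume n: "1 \<le> n" and x: "\<forall>i\<in>{1..m}. \<forall>k\<in>{1..n}. x i k \<in> E i"
    let ?K = "{1..m} \<rightarrow>\<^sub>E {1..n}"
    let ?Kl = "\<lambda>l. {k \<in> ?K. k j = l}"
    define N where "N k = norm (T (\<lambda>i\<in>{1..m}. x i (k i)))" for k
    \<comment> \<open>The \<open>p\<close>-norm of the slice with \<open>j\<close>-th index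
      \<open>l\<close>. A power of \<open>L\<close> will lie between the two sides of the
      claim.\<close>
    define S where "S l = ell p (?Kl l) N" for l
    define L where "L = (\<Sum>l=1..n. S l powr p')"
    \<comment> \<open>Extremal in Hoelder's inequality: the conjugate norm of \<open>a\<close> is
      exactly \<open>L powr \<kappa>\<close>.\<close>
    define a where "a l = S l powr (p' * \<kappa>)" for l
    define x' where "x' = x(j := \<lambda>l. a l *\<^sub>R x j l)"
    let ?w = "\<lambda>i. weak_norm scaleE (E i) ((q(j := s)) i) n (x i)"
    let ?R = "\<Prod>i=1..m. ?w i"
    have fin: "finite ?K"
      by (intro finite_PiE) auto
    have img: "(\<lambda>k. k j) ` ?K \<subseteq> {1..n}"
      using j(1) by auto
    have S_nonneg: "S l \<ge> 0" for l
      by (simp add: S_def ell_nonneg)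
    have w_nonneg: "0 \<le> ?w i" if "i \<in> {1..m}" for i
      using that x q s by (intro E.weak_norm_nonneg) auto
    have "L \<ge> 0"
      by (simp add: L_def sum_nonneg)
    have x': "x' i k \<in> E i" if "i \<in> {1..m}" "k \<in> {1..n}" for i k
      using that x E_subspace by (auto simp: x'_def intro!: E.subspace_scaleR)
    have N': "norm (T (\<lambda>i\<in>{1..m}. x' i (k i))) = a (k j) * N k" if k: "k \<in> ?K" for k
    proof -
      let ?y = "\<lambda>i\<in>{1..m}. x i (k i)"
      have y: "?y \<in> (\<Pi>\<^sub>E i\<in>{1..m}. E i)"
        using k x by (auto simp: PiE_iff)
      have "(\<lambda>i\<in>{1..m}. x' i (k i)) = ?y(j := a (k j) *\<^sub>R x j (k j))"
        using j(1) by (auto simp: x'_def fun_eq_iff)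
      moreover have "?y(j := x j (k j)) = ?y"
        using j(1) by auto
      moreover have "x j (k j) \<in> E j"
        using k x j(1) by (auto simp: PiE_iff)
      ultimately show ?thesis
        using T_scaleR[OF y j(1), of "x j (k j)" "a (k j)"] by (simp add: N_def a_def)
    qed
    have "L powr (1 / p) = T_ell p n x'"
    proof -
      have "(\<Sum>k\<in>?K. norm (T (\<lambda>i\<in>{1..m}. x' i (k i))) powr p) = (\<Sum>k\<in>?K. (a (k j) * N k) powr p)"
        using N' by (intro sum.cong) auto
      also have "\<dots> = (\<Sum>l=1..n. \<Sum>k\<in>?Kl l. (a (k j) * N k) powr p)"
        by (rule sum.group[OF fin finite_atLeastAtMost img, symmetric])
      also have "\<dots> = (\<Sum>l=1..n. a l powr p * S l powr p)"
        using p by (intro sum.cong) (auto simp: S_def ell_powr sum_distrib_left powr_mult a_def N_def)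
      also have "\<dots> = L"
        unfolding L_def a_def by (simp add: powr_powr exps flip: powr_add)
      finally show ?thesis
        by (simp add: T_ell_def ell_def)
    qed
    also have "\<dots> \<le> C * (\<Prod>i=1..m. weak_norm scaleE (E i) (q i) n (x' i))"
      using n x' by (intro C(2)) auto
    also have "\<dots> \<le> C * (L powr \<kappa> * ?R)"
    proof -
      have wj: "weak_norm scaleE (E j) (q j) n (x' j) \<le> L powr \<kappa> * ?w j"
      proof -
        have "weak_norm scaleE (E j) 1 n (\<lambda>l. a l *\<^sub>R x j l)
            \<le> ell (s / (s - 1)) {1..n} a * weak_norm scaleE (E j) s n (x j)"
          using x j(1) s by (intro E.weak_norm_scaleR_le) (auto simp: a_def)
        also have "ell (s / (s - 1)) {1..n} a = L powr \<kappa>"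
          unfolding \<kappa>(3) ell_def a_def L_def using \<kappa>(1) by (simp add: powr_powr)
        finally show ?thesis
          using j(2) by (simp add: x'_def)
      qed
      have "(\<Prod>i=1..m. weak_norm scaleE (E i) (q i) n (x' i))
          = weak_norm scaleE (E j) (q j) n (x' j) * (\<Prod>i\<in>{1..m} - {j}. ?w i)"
        using j(1) by (subst prod.remove[of _ j]) (auto simp: x'_def intro!: prod.cong)
      also have "\<dots> \<le> L powr \<kappa> * ?w j * (\<Prod>i\<in>{1..m} - {j}. ?w i)"
        by (intro mult_right_mono wj prod_nonneg w_nonneg) auto
      also have "\<dots> = L powr \<kappa> * ?R"
        using j(1) by (subst (2) prod.remove[of _ j]) auto
      finally show ?thesis
        using C(1) by (intro mult_left_mono)
    qed
    finally have key: "L powr (1 / p) \<le> L powr \<kappa> * (C * ?R)"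
      by (simp add: mult_ac)
    \<comment> \<open>Dividing by \<open>L powr \<kappa>\<close> lowers the exponent
      \<open>1 / p\<close> to \<open>1 / p'\<close>. For \<open>L = 0\<close> the left-hand side is
      0.\<close>
    have "L powr (1 / p') \<le> C * ?R"
    proof (cases "L = 0")
      case True
      have "0 \<le> ?R"
        using w_nonneg by (intro prod_nonneg)
      then show ?thesis
        using True C(1) by simp
    next
      case False
      then have "L > 0"
        using \<open>L \<ge> 0\<close> by simp
      then show ?thesis
        using key unfolding \<kappa>(2) powr_diff by (simp add: divide_le_eq mult.commute)
    qed
    \<comment> \<open>Within each slice the \<open>p'\<close>-norm is at most the
      \<open>p\<close>-norm, since \<open>p \<le> p'\<close>.\<close>
    moreover have "T_ell p' n x \<le> L powr (1 / p')"
    proof -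
      have "(\<Sum>k\<in>?K. N k powr p') = (\<Sum>l=1..n. \<Sum>k\<in>?Kl l. N k powr p')"
        by (rule sum.group[OF fin finite_atLeastAtMost img, symmetric])
      also have "\<dots> \<le> L"
        unfolding L_def
      proof (rule sum_mono)
        fix l
        have "ell p' (?Kl l) N \<le> S l"
          unfolding S_def using p pp' fin by (intro ell_antimono_exponent) (auto simp: N_def)
        then have "ell p' (?Kl l) N powr p' \<le> S l powr p'"
          using p by (intro powr_mono2 ell_nonneg) auto
        then show "(\<Sum>k\<in>?Kl l. N k powr p') \<le> S l powr p'"
          using p by (simp add: ell_powr)
      qed
      finally have "(\<Sum>k\<in>?K. N k powr p') powr (1 / p') \<le> L powr (1 / p')"
        using p(1,2) by (intro powr_mono2 sum_nonneg) auto
      then show ?thesis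
        by (simp add: T_ell_def ell_def N_def)
    qed
    ultimately show "T_ell p' n x \<le> C * ?R"
      by (rule order_trans[rotated])
  qed (rule C(1))
qed

text \<open>Every step lowers the reciprocal of the strong exponent, so positivity at the end
  ensures positivity at all earlier stages.\<close>

lemma multiple_summing_iterate:
  assumes cot: "has_cotype TYPE('w) (ereal \<rho>)" and s: "s > 1"
    and J: "finite J" "J \<subseteq> {1..m}" and pos: "1 / \<rho> - card J * (1 - 1 / s) > 0"
  shows "multiple_summing (1 / (1 / \<rho> - card J * (1 - 1 / s))) (\<lambda>i. if i \<in> J then s else 1)"
  using J pos
proof induction
  case empty
  then show ?case
    using multiple_summing_cotype[OF cot] by simp
next
  case (insert j J)
  let ?u = "1 / \<rho> - card J * (1 - 1 / s)"
  have "1 - 1 / s > 0"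
    using s by simp
  moreover have u: "1 / \<rho> - card (insert j J) * (1 - 1 / s) = ?u - (1 - 1 / s)"
    using insert.hyps by (simp add: algebra_simps)
  ultimately have "?u > 0"
    using insert.prems by linarith
  have "multiple_summing (1 / (?u - (1 - 1 / s))) ((\<lambda>i. if i \<in> J then s else 1)(j := s))"
  proof (rule multiple_summing_step)
    show "multiple_summing (1 / ?u) (\<lambda>i. if i \<in> J then s else 1)"
      using insert \<open>?u > 0\<close> by auto
  qed (use insert s \<open>?u > 0\<close> u in auto)
  moreover have "(\<lambda>i. if i \<in> J then s else 1)(j := s) = (\<lambda>i. if i \<in> insert j J then s else 1)"
    by auto
  ultimately show ?case
    unfolding u by simp
qed

text \<open>For \<open>s = 1\<close> the conjugate exponent would be infinite and nothing has to be
  raised, so that case rests on cotype directly.\<close>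

lemma multiple_summing_weak_exponent:
  assumes cot: "has_cotype TYPE('w) (ereal \<rho>)" and s: "s \<ge> 1" and pos: "1 / \<rho> - m * (1 - 1 / s) > 0"
  shows "multiple_summing (1 / (1 / \<rho> - m * (1 - 1 / s))) (\<lambda>_. s)"
proof (cases "s = 1")
  case True
  then show ?thesis
    using multiple_summing_cotype[OF cot] by simp
next
  case False
  have "multiple_summing (1 / (1 / \<rho> - m * (1 - 1 / s))) (\<lambda>i. if i \<in> {1..m} then s else 1)"
    using multiple_summing_iterate[OF cot, of s "{1..m}"] s pos False by simp
  then show ?thesis
    by (simp add: multiple_summing_def cong: prod.cong_simp)
qed

text \<open>The strong norm runs over \<open>n ^ m\<close> index tuples, so its change of exponent
  costs the power \<open>m * (1 / p - 1 / t)\<close> of \<open>n\<close>. Each of the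
  \<open>m\<close> weak norms costs the power \<open>1 / s - 1 / q\<close>. Negative differences
  cost nothing.\<close>

lemma multiple_summing_change_exponents:
  assumes ms: "multiple_summing t (\<lambda>_. s)" and pos: "t > 0" "s > 0" "p > 0" "q > 0"
    and \<sigma>: "m * max 0 (1 / p - 1 / t) + m * max 0 (1 / s - 1 / q) \<le> \<sigma>"
  shows "\<exists>C\<ge>0. \<forall>n\<ge>1. \<forall>x. (\<forall>i\<in>{1..m}. \<forall>k\<in>{1..n}. x i k \<in> E i) \<longrightarrow>
    T_ell p n x \<le> C * real n powr \<sigma> * (\<Prod>i=1..m. weak_norm scaleE (E i) q n (x i))"
proof -
  obtain C where C: "C \<ge> 0" "\<And>n x. \<lbrakk>n \<ge> 1; \<And>i k. i \<in> {1..m} \<Longrightarrow> k \<in> {1..n} \<Longrightarrow> x i k \<in> E i\<rbrakk>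
     \<Longrightarrow> T_ell t n x \<le> C * (\<Prod>i=1..m. weak_norm scaleE (E i) s n (x i))"
    using ms unfolding multiple_summing_def by auto
  define \<alpha> where "\<alpha> = max 0 (1 / p - 1 / t)"
  define \<beta> where "\<beta> = max 0 (1 / s - 1 / q)"
  show ?thesis
  proof (intro exI[of _ C] conjI allI impI)
    fix n :: nat and x :: "nat \<Rightarrow> nat \<Rightarrow> 'v"
    assume n: "1 \<le> n" and x: "\<forall>i\<in>{1..m}. \<forall>k\<in>{1..n}. x i k \<in> E i"
    let ?K = "{1..m} \<rightarrow>\<^sub>E {1..n}"
    let ?R = "\<Prod>i=1..m. weak_norm scaleE (E i) q n (x i)"
    have R: "0 \<le> ?R"
      using x pos by (intro prod_nonneg E.weak_norm_nonneg) auto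
    have "T_ell p n x \<le> real (card ?K) powr \<alpha> * T_ell t n x"
      unfolding T_ell_def \<alpha>_def using pos n
      by (intro ell_le_card_max) (auto intro!: finite_PiE simp: PiE_eq_empty_iff)
    also have "real (card ?K) = real n powr m"
      using n by (simp add: card_PiE powr_realpow)
    also have "(real n powr m) powr \<alpha> * T_ell t n x \<le> (real n powr m) powr \<alpha> * (C * (real n powr (m * \<beta>) * ?R))"
    proof (rule mult_left_mono)
      have "T_ell t n x \<le> C * (\<Prod>i=1..m. weak_norm scaleE (E i) s n (x i))"
        using n x by (intro C(2)) auto
      also have "\<dots> \<le> C * (\<Prod>i=1..m. real n powr \<beta> * weak_norm scaleE (E i) q n (x i))"
        using C(1) n x pos unfolding \<beta>_def
        by (intro mult_left_mono prod_mono conjI E.weak_norm_nonneg E.weak_norm_le_card_max) auto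
      also have "(\<Prod>i=1..m. real n powr \<beta> * weak_norm scaleE (E i) q n (x i)) = real n powr (m * \<beta>) * ?R"
        using n by (simp add: prod.distrib powr_power mult.commute)
      finally show "T_ell t n x \<le> C * (real n powr (m * \<beta>) * ?R)" .
    qed simp
    also have "\<dots> = C * real n powr (m * \<alpha> + m * \<beta>) * ?R"
      by (simp add: powr_powr powr_add)
    also have "\<dots> \<le> C * real n powr \<sigma> * ?R"
      using n \<sigma> C(1) R by (intro mult_right_mono mult_left_mono powr_mono) (auto simp: \<alpha>_def \<beta>_def)
    finally show "T_ell p n x \<le> C * real n powr \<sigma> * ?R" .
  qed (rule C(1))
qed

end

section \<open>The index of summability\<close>

text \<open>It suffices that \<open>\<sigma>\<close> is admissible for every \<open>T\<close>. Here
  \<open>u\<close> is the reciprocal of the strong exponent reached once all weak exponents equal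
  \<open>s\<close>.\<close>

lemma mult_index_le_of_cotype:
  fixes scaleE :: "'k::real_or_complex \<Rightarrow> 'v::banach \<Rightarrow> 'v" and scaleF :: "'k \<Rightarrow> 'w::banach \<Rightarrow> 'w"
  assumes "normed_space_over scaleE" and "normed_space_over scaleF"
    and E: "\<And>i. i \<in> {1..m} \<Longrightarrow> module.subspace scaleE (E i)"
    and cot: "has_cotype TYPE('w) (ereal \<rho>)"
    and s: "s \<ge> 1" and u: "u = 1 / \<rho> - real m * (1 - 1 / s)" "u > 0" and "p > 0" "q > 0"
    and \<sigma>: "real m * max 0 (1 / p - u) + real m * max 0 (1 / s - 1 / q) \<le> \<sigma>"
  shows "mult_index scaleE scaleF m E p q \<le> ereal \<sigma>"
  unfolding mult_index_def
proof (intro Inf_lower image_eqI[OF refl] CollectI conjI ballI)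
  show "0 \<le> \<sigma>"
    using \<sigma> by (rule order_trans[rotated]) simp
  fix T assume T: "T \<in> continuous_multilinear scaleE scaleF m E"
  interpret E: banach_space_over scaleE
    using assms(1) by (simp add: banach_space_over_def)
  interpret multilinear_operator scaleE scaleF m E T
    using assms(2) E T E.banach_space_over_axioms
    by (simp add: multilinear_operator_def multilinear_operator_axioms_def)
  have "multiple_summing (1 / u) (\<lambda>_. s)"
    using multiple_summing_weak_exponent[OF cot s] u by simp
  from multiple_summing_change_exponents[OF this, of p q \<sigma>] assms
  show "\<exists>C\<ge>0. \<forall>n\<ge>1. \<forall>x :: nat \<Rightarrow> nat \<Rightarrow> 'v.
      (\<forall>i\<in>{1..m}. \<forall>k\<in>{1..n}. x i k \<in> E i) \<longrightarrow>
      (\<Sum>k\<in>{1..m} \<rightarrow>\<^sub>E {1..n}. norm (T (\<lambda>i\<in>{1..m}. x i (k i))) powr p) powr (1 / p)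
      \<le> C * real n powr \<sigma> * (\<Prod>i=1..m. weak_norm scaleE (E i) q n (x i))"
    by (simp add: T_ell_def ell_def)
qed

lemma mult_index_nonneg: "0 \<le> mult_index scaleE scaleF m E p q"
  unfolding mult_index_def by (intro Inf_greatest) auto

text \<open>The infimum \<open>r\<close> need not be attained. A cotype close enough to
  \<open>r\<close> lowers \<open>u\<close> by less than \<open>\<theta>\<close> and hence raises the
  bound by at most \<open>e\<close>, which is arbitrary.\<close>

lemma mult_index_le_of_inf_cotype:
  fixes scaleE :: "'k::real_or_complex \<Rightarrow> 'v::banach \<Rightarrow> 'v" and scaleF :: "'k \<Rightarrow> 'w::banach \<Rightarrow> 'w"
  assumes "normed_space_over scaleE" and "normed_space_over scaleF"
    and E: "\<And>i. i \<in> {1..m} \<Longrightarrow> module.subspace scaleE (E i)"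
    and cot: "inf_cotype TYPE('w) = ereal r" "r > 0"
    and s: "s \<ge> 1" and u: "u = 1 / r - real m * (1 - 1 / s)" "u > 0" and "p > 0" "q > 0"
  shows "mult_index scaleE scaleF m E p q
      \<le> ereal (real m * max 0 (1 / p - u) + real m * max 0 (1 / s - 1 / q))"
proof (rule ereal_le_epsilon2)
  fix e :: real assume "e > 0"
  \<comment> \<open>Below \<open>u\<close>, so that the perturbed reciprocal exponent stays
    positive. The denominator \<open>m + 1\<close> also covers \<open>m = 0\<close>.\<close>
  define \<theta> where "\<theta> = min (e / (m + 1)) (u / 2)"
  have \<theta>: "0 < \<theta>" "\<theta> < u" "m * \<theta> \<le> e"
  proof -
    show "0 < \<theta>"
      using \<open>e > 0\<close> u(2) by (simp add: \<theta>_def)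
    have "\<theta> \<le> u / 2"
      unfolding \<theta>_def by (rule min.cobounded2)
    then show "\<theta> < u"
      using u(2) by linarith
    have "m * \<theta> \<le> m * (e / (m + 1))"
      by (intro mult_left_mono) (auto simp: \<theta>_def)
    also have "\<dots> \<le> e"
      using \<open>e > 0\<close> by (simp add: field_simps)
    finally show "m * \<theta> \<le> e" .
  qed
  have "u \<le> 1 / r"
    using s u by simp
  then have pos: "1 / r - \<theta> > 0"
    using \<theta> by simp
  have "r < 1 / (1 / r - \<theta>)"
    using pos \<theta> cot(2) by (simp add: field_simps)
  then have "Inf {\<rho>. has_cotype TYPE('w) \<rho>} < ereal (1 / (1 / r - \<theta>))"
    using cot(1) by (simp add: inf_cotype_def)
  then obtain \<rho>' where \<rho>': "has_cotype TYPE('w) \<rho>'" "\<rho>' < ereal (1 / (1 / r - \<theta>))"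
    by (auto simp: Inf_less_iff)
  then have "2 \<le> \<rho>'"
    by (simp add: has_cotype_def)
  \<comment> \<open>Being at least 2 and below a real number, \<open>\<rho>'\<close> is
    finite.\<close>
  with \<rho>' obtain \<rho> where \<rho>: "\<rho>' = ereal \<rho>" "\<rho> \<ge> 2" "\<rho> < 1 / (1 / r - \<theta>)"
    by (cases \<rho>') auto
  have \<rho>u: "1 / \<rho> > 1 / r - \<theta>"
    using \<rho> pos by (simp add: field_simps)
  define u' where "u' = 1 / \<rho> - real m * (1 - 1 / s)"
  have u': "u' > u - \<theta>"
    using \<rho>u u by (simp add: u'_def)
  have "real m * max 0 (1 / p - u') \<le> real m * (max 0 (1 / p - u) + \<theta>)"
    using u' \<theta> by (intro mult_left_mono) auto
  then have "real m * max 0 (1 / p - u') + real m * max 0 (1 / s - 1 / q)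
      \<le> real m * max 0 (1 / p - u) + real m * max 0 (1 / s - 1 / q) + e"
    using \<theta>(3) by (simp add: distrib_left)
  then have "mult_index scaleE scaleF m E p q
      \<le> ereal (real m * max 0 (1 / p - u) + real m * max 0 (1 / s - 1 / q) + e)"
    using assms(1-3) \<rho>' \<rho>(1) s u' \<theta>(2) \<open>p > 0\<close> \<open>q > 0\<close>
    by (intro mult_index_le_of_cotype[where \<rho> = \<rho> and u = u']) (auto simp: u'_def)
  then show "mult_index scaleE scaleF m E p q
      \<le> ereal (real m * max 0 (1 / p - u) + real m * max 0 (1 / s - 1 / q)) + ereal e"
    by simp
qed

lemma inf_cotype_ge_2: "2 \<le> inf_cotype TYPE('w::banach)"
  unfolding inf_cotype_def by (intro Inf_greatest) (simp add: has_cotype_def)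

theorem corollary2p3:
  fixes scaleE :: "'k::real_or_complex \<Rightarrow> 'v::banach \<Rightarrow> 'v"
    and scaleF :: "'k \<Rightarrow> 'w::banach \<Rightarrow> 'w"
    and m :: nat and E :: "nat \<Rightarrow> 'v set" and r s t p q :: real
  assumes "normed_space_over scaleE" and "normed_space_over scaleF"
    and "m \<ge> 1"
    and "\<And>i. i \<in> {1..m} \<Longrightarrow> banach_subspace scaleE (E i) \<and> infinite_dimensional scaleE (E i)"
    and "infinite_dimensional scaleF (UNIV :: 'w set)"
    and "inf_cotype TYPE('w) = ereal r"
    and "1 \<le> s" and "s < 2"
    and "s = 1 \<or> real m < s / (r * (s - 1))"
    and "t = s * r / (s - real m * s * r + real m * r)"
  shows "(0 < p \<and> p \<le> t \<and> real m * r * t / (r - t + real m * r * t) \<le> q \<longrightarrow>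
            mult_index scaleE scaleF m E p q \<le> ereal (real m / p + real m - 1 / r - real m / q - (real m - 1) / t))
       \<and> (0 < p \<and> p \<le> t \<and> 0 < q \<and> q \<le> real m * r * t / (r - t + real m * r * t) \<longrightarrow>
            mult_index scaleE scaleF m E p q \<le> ereal (real m / p - real m / t))
       \<and> (0 < t \<and> t \<le> p \<and> real m * r * t / (r - t + real m * r * t) \<le> q \<longrightarrow>
            mult_index scaleE scaleF m E p q \<le> ereal (real m - 1 / r + 1 / t - real m / q))
       \<and> (0 < t \<and> t \<le> p \<and> 0 < q \<and> q \<le> real m * r * t / (r - t + real m * r * t) \<longrightarrow>
            mult_index scaleE scaleF m E p q = 0)"
proof -
  have r: "r \<ge> 2"
    using inf_cotype_ge_2[where ?'w = 'w] assms(6) by simp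
  have s: "s > 0"
    using assms by simp
  \<comment> \<open>The hypothesis relating \<open>m\<close>, \<open>s\<close> and \<open>r\<close>
    makes the denominator of \<open>t\<close> positive.\<close>
  have D: "s - real m * s * r + real m * r > 0"
  proof (cases "s = 1")
    case False
    then have "real m * (r * (s - 1)) < s"
      using assms r by (simp add: pos_less_divide_eq)
    then show ?thesis
      by (simp add: algebra_simps)
  qed (use r in simp)
  then have t: "t > 0"
    using assms(10) r s by simp
  \<comment> \<open>Identifies \<open>1 / t\<close> with the quantity \<open>u\<close> of
    \<open>mult_index_le_of_inf_cotype\<close>.\<close>
  have inv_t: "1 / t = 1 / r - real m * (1 - 1 / s)"
  proof -
    have "1 / t = (s - real m * s * r + real m * r) / (s * r)"
      using assms(10) by simp
    then show ?thesis
      using r s by (simp add: field_simps)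
  qed
  \<comment> \<open>Clearing denominators in \<open>inv_t\<close> shows that the denominator of the
    threshold for \<open>q\<close> is its numerator divided by \<open>s\<close>.\<close>
  have den: "r - t + real m * r * t = real m * r * t / s"
  proof -
    have "r * t * (1 / t) = r * t * (1 / r - real m * (1 - 1 / s))"
      using inv_t by simp
    then have "r = t - real m * r * t * (1 - 1 / s)"
      using r t by (simp add: right_diff_distrib mult_ac)
    then show ?thesis
      by (simp add: right_diff_distrib)
  qed
  have crit: "real m * r * t / (r - t + real m * r * t) = s"
    unfolding den using assms(3) r s t by simp
  have sub: "module.subspace scaleE (E i)" if "i \<in> {1..m}" for i
    using assms(4)[OF that] by (simp add: banach_subspace_def)
  have index: "mult_index scaleE scaleF m E p q
      \<le> ereal (real m * max 0 (1 / p - 1 / t) + real m * max 0 (1 / s - 1 / q))" if "p > 0" "q > 0"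
    using assms(1,2,6,7) sub r t that
    by (intro mult_index_le_of_inf_cotype[where r = r] inv_t) auto
  have pt: "p \<le> t \<Longrightarrow> p > 0 \<Longrightarrow> max 0 (1 / p - 1 / t) = 1 / p - 1 / t"
    "t \<le> p \<Longrightarrow> max 0 (1 / p - 1 / t) = 0"
    using t by (auto intro!: max_absorb1 max_absorb2 simp: frac_le)
  have qs: "s \<le> q \<Longrightarrow> max 0 (1 / s - 1 / q) = 1 / s - 1 / q"
    "q \<le> s \<Longrightarrow> q > 0 \<Longrightarrow> max 0 (1 / s - 1 / q) = 0"
    using s by (auto intro!: max_absorb1 max_absorb2 simp: frac_le)
  \<comment> \<open>Eliminates \<open>s\<close> from the bounds in the two cases with
    \<open>s \<le> q\<close>.\<close>
  have ms: "real m / s = real m - 1 / r + 1 / t"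
    using inv_t by (simp add: right_diff_distrib)
  have scale: "real m * (1 / x - 1 / y) = real m / x - real m / y" for x y :: real
    by (simp add: right_diff_distrib)
  show ?thesis
    unfolding crit
  proof (intro conjI impI; elim conjE)
    \<comment> \<open>The positivity of \<open>q\<close> that \<open>index\<close> requires follows
      from \<open>0 < s\<close> and \<open>s \<le> q\<close>.\<close>
    assume "0 < p" "p \<le> t" "s \<le> q"
    then show "mult_index scaleE scaleF m E p q
        \<le> ereal (real m / p + real m - 1 / r - real m / q - (real m - 1) / t)"
      using index s by (simp add: pt qs scale ms diff_divide_distrib algebra_simps)
  next
    assume "0 < p" "p \<le> t" "0 < q" "q \<le> s"
    then show "mult_index scaleE scaleF m E p q \<le> ereal (real m / p - real m / t)"
      using index by (simp add: pt qs scale)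
  next
    assume "0 < t" "t \<le> p" "s \<le> q"
    then show "mult_index scaleE scaleF m E p q \<le> ereal (real m - 1 / r + 1 / t - real m / q)"
      using index s by (simp add: pt qs scale ms)
  next
    assume "0 < t" "t \<le> p" "0 < q" "q \<le> s"
    then have "mult_index scaleE scaleF m E p q \<le> 0"
      using index by (simp add: pt qs zero_ereal_def)
    then show "mult_index scaleE scaleF m E p q = 0"
      using mult_index_nonneg by (rule antisym)
  qed
qed

end
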